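(* Let $\alpha\in\mathbb{C}$ and consider the second Painlevé equation $dx/dz = 2y^3+yz+\alpha$, $dy/dz=x$, and the coordinates $X_2=xy^{-2}$, $Z_2=zy^{-2}$, $\varepsilon_2=y^{-3}$. Near each of the two points $(X_2,Z_2,\varepsilon_2)=(\mp1,0,0)$ there exists a local analytic transformation $(x,z)\mapsto(\tilde x,\tilde z)$ (with $\tilde y=y$ unchanged) such that the second Painlevé equation is transformed into the solvable system $$\frac{d\tilde x}{d\tilde z} = \pm2\tilde x\tilde y+4\tilde y^3+\tilde z\tilde y+\alpha,\qquad \frac{d\tilde y}{d\tilde z}=\mp\tilde y^2,$$ where the upper signs are taken near $(-1,0,0)$ and the lower signs near $(1,0,0)$.
   Context: The coordinates $(X_2,Z_2,\varepsilon_2)$ are inhomogeneous coordinates of the weighted projective space $\mathbb{C}P^3(2,1,2,3)$, related to $(x,y,z)$ by $x=X_2\varepsilon_2^{-2/3}$, $y=\varepsilon_2^{-1/3}$, $z=Z_2\varepsilon_2^{-2/3}$. A "local analytic transformation $(x,z)\mapsto(\tilde x,\tilde z)$ near a point $P$ of this chart" means: a biholomorphic map $(X_2,Z_2,\varepsilon_2)\mapsto(u_2,v_2,\varepsilon_2)$ defined in a neighborhood of $P$, fixing $P$ and leaving $\varepsilon_2$ (hence $y$) unchanged, with $\tilde x=u_2y^{2}$, $\tilde y=y$, $\tilde z=v_2y^{2}$. "Is transformed into" means that solutions of the second Painlevé equation lying in this neighborhood (with $\varepsilon_2\ne0$) are mapped to solutions of the displayed system, $\tilde z$ being the new independent variable.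 *)

theory Defs
  imports "HOL-Analysis.Analysis"
begin

type_synonym complex3 = "complex \<times> complex \<times> complex"

fun cscale3 :: "complex \<Rightarrow> complex3 \<Rightarrow> complex3" where
  "cscale3 c (a, b, d) = (c * a, c * b, c * d)"

text \<open>Holomorphy in several variables is complex Frechet differentiability on an open set.
  The predicate has_derivative already makes the derivative real linear, so homogeneity over the
  complex numbers is all that has to be added.\<close>

definition holomorphic3_on :: "(complex3 \<Rightarrow> complex3) \<Rightarrow> complex3 set \<Rightarrow> bool" where
  "holomorphic3_on \<Phi> U \<longleftrightarrow> open U \<and>
     (\<forall>p\<in>U. \<exists>D. (\<Phi> has_derivative D) (at p) \<and>
        (\<forall>c h. D (cscale3 c h) = cscale3 c (D h)))"

definition biholomorphic3_on :: "(complex3 \<Rightarrow> complex3) \<Rightarrow> complex3 set \<Rightarrow> bool" where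
  "biholomorphic3_on \<Phi> U \<longleftrightarrow>
     holomorphic3_on \<Phi> U \<and> inj_on \<Phi> U \<and> holomorphic3_on (inv_into U \<Phi>) (\<Phi> ` U)"

text \<open>A non-autonomous system sends (x, y, z) to the pair (dx/dz, dy/dz).\<close>

type_synonym ode_system = "complex \<Rightarrow> complex \<Rightarrow> complex \<Rightarrow> complex \<times> complex"

definition solves_on ::
    "ode_system \<Rightarrow> complex set \<Rightarrow> (complex \<Rightarrow> complex) \<Rightarrow> (complex \<Rightarrow> complex) \<Rightarrow> bool" where
  "solves_on F S x y \<longleftrightarrow> open S \<and>
     (\<forall>z\<in>S. (x has_field_derivative fst (F (x z) (y z) z)) (at z) \<and>
            (y has_field_derivative snd (F (x z) (y z) z)) (at z))"

definition painleve2 :: "complex \<Rightarrow> ode_system" where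
  "painleve2 \<alpha> x y z = (2 * y^3 + y * z + \<alpha>, x)"

text \<open>The parameter s is 1 for the upper signs and -1 for the lower signs.\<close>

definition solvable_system :: "complex \<Rightarrow> complex \<Rightarrow> ode_system" where
  "solvable_system s \<alpha> x y z = (s * (2 * x * y) + 4 * y^3 + z * y + \<alpha>, - s * y^2)"

text \<open>The coordinates (X2, Z2, eps2); meaningful only for nonzero y.\<close>

definition chart2 :: "complex \<Rightarrow> complex \<Rightarrow> complex \<Rightarrow> complex3" where
  "chart2 x y z = (x / y^2, z / y^2, 1 / y^3)"

definition local_transformation_near :: "complex3 \<Rightarrow> complex3 set \<Rightarrow> (complex3 \<Rightarrow> complex3) \<Rightarrow> bool" where
  "local_transformation_near P U \<Phi> \<longleftrightarrow>
     P \<in> U \<and> biholomorphic3_on \<Phi> U \<and> \<Phi> P = P \<and> (\<forall>p\<in>U. snd (snd (\<Phi> p)) = snd (snd p))"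

text \<open>With (u, v, eps) the image of (X2, Z2, eps2), the new variables are u y^2 and v y^2.
  Since y itself is at hand, no branch of a cube root of eps2 has to be chosen.\<close>

definition new_x :: "(complex3 \<Rightarrow> complex3) \<Rightarrow> complex \<Rightarrow> complex \<Rightarrow> complex \<Rightarrow> complex" where
  "new_x \<Phi> x y z = fst (\<Phi> (chart2 x y z)) * y^2"

definition new_z :: "(complex3 \<Rightarrow> complex3) \<Rightarrow> complex \<Rightarrow> complex \<Rightarrow> complex \<Rightarrow> complex" where
  "new_z \<Phi> x y z = fst (snd (\<Phi> (chart2 x y z))) * y^2"

text \<open>Along a solution of F in U, the new z is locally injective, hence an admissible independent
  variable, and the new x and the old y, regarded as functions xt and yt of it, solve G.
  Global injectivity on S cannot be expected, as S is an arbitrary open set.\<close>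

definition transforms_into ::
    "(complex3 \<Rightarrow> complex3) \<Rightarrow> complex3 set \<Rightarrow> ode_system \<Rightarrow> ode_system \<Rightarrow> bool" where
  "transforms_into \<Phi> U F G \<longleftrightarrow>
     (\<forall>S x y. solves_on F S x y \<and> (\<forall>z\<in>S. y z \<noteq> 0 \<and> chart2 (x z) (y z) z \<in> U) \<longrightarrow>
       (\<forall>z0\<in>S. \<exists>T xt yt.
          open T \<and> z0 \<in> T \<and> T \<subseteq> S \<and>
          inj_on (\<lambda>z. new_z \<Phi> (x z) (y z) z) T \<and>
          solves_on G ((\<lambda>z. new_z \<Phi> (x z) (y z) z) ` T) xt yt \<and>
          (\<forall>z\<in>T. xt (new_z \<Phi> (x z) (y z) z) = new_x \<Phi> (x z) (y z) z \<and>
                 yt (new_z \<Phi> (x z) (y z) z) = y z)))"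

end

theory Submission
  imports Defs "HOL-Complex_Analysis.Complex_Analysis"
begin

text \<open>Every solution with a pole of residue \<open>s\<close> is regular in terms of \<open>\<lambda> = 1 / y\<close>: with
  \<open>X\<^sub>2\<^sup>2 = 1 + \<lambda>\<^sup>2 z + (2 \<alpha> + s) \<lambda>\<^sup>3 + h \<lambda>\<^sup>4\<close> and \<open>r = - s / X\<^sub>2\<close>, the second Painleve equation becomes
  \<open>dz / d\<lambda> = s r\<close>, \<open>dh / d\<lambda> = s (1 - r) / \<lambda>\<^sup>2\<close>, whose right-hand sides are analytic at \<open>\<lambda> = 0\<close>.  The initial
  values \<open>z\<^sub>0\<close> and \<open>h\<^sub>0\<close> at \<open>\<lambda> = 0\<close> are first integrals.  In the weighted coordinates
  \<open>p = (u, v, e) = (h\<^sub>0 \<lambda>\<^sup>4, z\<^sub>0 \<lambda>\<^sup>2, \<lambda>\<^sup>3)\<close> the Painleve vector field is therefore proportional to the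
  Euler field \<open>(4 u, 2 v, 3 e)\<close>, and so is, after an affine change of coordinates, the solvable system.
  The chart coordinates are constructed as sums of weighted homogeneous polynomials in \<open>p\<close>, which
  converge near \<open>p = 0\<close>; the required transformation is the local inverse of the resulting map.\<close>

subsection \<open>Holomorphic functions of three variables\<close>

text \<open>The triple type is only a real normed space, so complex linearity has to be expressed
  through the explicit scaling \<open>cscale3\<close>.\<close>

definition clinear3 :: "(complex3 \<Rightarrow> complex) \<Rightarrow> bool" where
  "clinear3 D \<longleftrightarrow> (\<forall>c h. D (cscale3 c h) = c * D h)"

definition has_cderiv3 :: "(complex3 \<Rightarrow> complex) \<Rightarrow> (complex3 \<Rightarrow> complex) \<Rightarrow> complex3 \<Rightarrow> bool" where
  "has_cderiv3 f D p \<longleftrightarrow> (f has_derivative D) (at p) \<and> clinear3 D"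

lemma norm_cscale3: "norm (cscale3 c h) = norm c * norm h"
proof (cases h)
  case (fields a b d)
  have "(norm c * norm a)\<^sup>2 + ((norm c * norm b)\<^sup>2 + (norm c * norm d)\<^sup>2)
      = (norm c)\<^sup>2 * ((norm a)\<^sup>2 + ((norm b)\<^sup>2 + (norm d)\<^sup>2))"
    by (simp add: algebra_simps power_mult_distrib)
  then show ?thesis
    by (simp add: fields norm_prod_def norm_mult real_sqrt_mult)
qed

lemma cscale3_has_derivative: "((\<lambda>w. cscale3 w h) has_derivative (\<lambda>w. cscale3 w h)) (at w)"
  by (cases h) (auto intro!: derivative_eq_intros)

lemma cscale3_zero [simp]: "cscale3 0 h = 0"
  by (cases h) (simp add: zero_prod_def)

lemma cscale3_cscale3: "cscale3 c (cscale3 d h) = cscale3 (c * d) h"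
  by (cases h) simp

lemma norm_complex3_le: "norm (h :: complex3) \<le> norm (fst h) + norm (fst (snd h)) + norm (snd (snd h))"
  using norm_Pair_le[of "fst h" "snd h"] norm_Pair_le[of "fst (snd h)" "snd (snd h)"] by simp

lemma has_cderiv3_add:
  "has_cderiv3 f D p \<Longrightarrow> has_cderiv3 g E p \<Longrightarrow> has_cderiv3 (\<lambda>p. f p + g p) (\<lambda>h. D h + E h) p"
  by (auto simp: has_cderiv3_def clinear3_def algebra_simps intro: has_derivative_add)

lemma has_cderiv3_cmult: "has_cderiv3 f D p \<Longrightarrow> has_cderiv3 (\<lambda>p. c * f p) (\<lambda>h. c * D h) p"
  by (auto simp: has_cderiv3_def clinear3_def algebra_simps intro: has_derivative_mult_right)

lemma has_cderiv3_diff: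
  "has_cderiv3 f D p \<Longrightarrow> has_cderiv3 g E p \<Longrightarrow> has_cderiv3 (\<lambda>p. f p - g p) (\<lambda>h. D h - E h) p"
  by (auto simp: has_cderiv3_def clinear3_def algebra_simps intro: has_derivative_diff)

lemma has_cderiv3_mult:
  "has_cderiv3 f D p \<Longrightarrow> has_cderiv3 g E p \<Longrightarrow> has_cderiv3 (\<lambda>p. f p * g p) (\<lambda>h. f p * E h + D h * g p) p"
  by (auto simp: has_cderiv3_def clinear3_def distrib_left mult.assoc mult.left_commute
      simp del: split_paired_All intro: has_derivative_mult)

lemma has_cderiv3_const: "has_cderiv3 (\<lambda>p. c) (\<lambda>h. 0) p"
  by (auto simp: has_cderiv3_def clinear3_def)

lemma has_cderiv3_coord:
  "has_cderiv3 fst fst p" "has_cderiv3 (\<lambda>p. fst (snd p)) (\<lambda>h. fst (snd h)) p"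
  "has_cderiv3 (\<lambda>p. snd (snd p)) (\<lambda>h. snd (snd h)) p"
  by (auto simp: has_cderiv3_def clinear3_def intro!: derivative_eq_intros)

text \<open>Restriction to a complex line is the only way in which one-variable function theory
  enters the several-variable estimates.\<close>

lemma has_cderiv3_along_line:
  assumes "has_cderiv3 f D (p + cscale3 w h)"
  shows "((\<lambda>w. f (p + cscale3 w h)) has_field_derivative D h) (at w)"
proof -
  have "((\<lambda>w. p + cscale3 w h) has_derivative (\<lambda>w. cscale3 w h)) (at w)"
    by (auto intro!: derivative_eq_intros cscale3_has_derivative)
  then have "((\<lambda>w. f (p + cscale3 w h)) has_derivative (\<lambda>w. D (cscale3 w h))) (at w)"
    using has_derivative_compose[of "\<lambda>w. p + cscale3 w h" "\<lambda>w. cscale3 w h" w UNIV f D] assms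
    by (simp add: has_cderiv3_def)
  moreover have "(\<lambda>w. D (cscale3 w h)) = (*) (D h)"
    using assms by (intro ext) (simp add: has_cderiv3_def clinear3_def del: split_paired_All)
  ultimately show ?thesis
    by (simp add: has_field_derivative_def)
qed

text \<open>The one-variable Cauchy inequality is applied on the line through \<open>p\<close> in
  direction \<open>h\<close>. The disc of radius \<open>R = r / (2 * norm h)\<close> covers half the
  ball, so its closure stays inside; this half is the source of the factor 2.\<close>

lemma Cauchy_estimate3:
  assumes r: "r > 0" and hol: "\<And>q. q \<in> ball p r \<Longrightarrow> \<exists>D. has_cderiv3 f D q"
    and bound: "\<And>q. q \<in> ball p r \<Longrightarrow> norm (f q) \<le> B" and D: "has_cderiv3 f D p"
  shows "norm (D h) \<le> 2 * B / r * norm h"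
proof (cases "h = 0")
  case True
  have "D 0 = 0"
    using D by (auto simp: has_cderiv3_def intro: linear_0 has_derivative_linear)
  with True show ?thesis by simp
next
  case False
  define R where "R = r / (2 * norm h)"
  have R: "R > 0" using False r by (simp add: R_def)
  have inb: "p + cscale3 w h \<in> ball p r" if "norm w \<le> R" for w
  proof -
    have "norm w * norm h \<le> R * norm h" using that by (simp add: mult_right_mono)
    also have "\<dots> < r" using False r by (simp add: R_def)
    finally show ?thesis by (simp add: dist_norm norm_cscale3)
  qed
  let ?g = "\<lambda>w. f (p + cscale3 w h)"
  have diff: "?g field_differentiable at w" if "norm w \<le> R" for w
    using hol[OF inb[OF that]] has_cderiv3_along_line field_differentiable_def by blast
  have "norm ((deriv ^^ 1) ?g 0) \<le> fact 1 * B / R ^ 1"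
  proof (rule Cauchy_inequality)
    show "?g holomorphic_on ball 0 R"
      using diff by (force simp: holomorphic_on_def intro: field_differentiable_at_within)
    show "continuous_on (cball 0 R) ?g"
      using diff by (intro continuous_at_imp_continuous_on ballI)
        (auto intro: field_differentiable_imp_continuous_at)
    show "norm (?g w) \<le> B" if "norm (0 - w) = R" for w
      using bound[OF inb] that by simp
  qed (rule R)
  moreover have "deriv ?g 0 = D h"
    using has_cderiv3_along_line[of f D p 0 h] D by (intro DERIV_imp_deriv) simp
  ultimately show ?thesis
    using False by (simp add: R_def field_simps)
qed

text \<open>Only the terms are assumed to decay. Cauchy estimates on balls of radius
  \<open>\<rho>/2\<close> give the derivatives the same geometric decay, uniformly on the half ball,
  and this is what termwise differentiation requires.\<close>

lemma has_cderiv3_suminf: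
  fixes f :: "nat \<Rightarrow> complex3 \<Rightarrow> complex"
  assumes \<rho>: "\<rho> > 0" and D: "\<And>n p. p \<in> ball 0 \<rho> \<Longrightarrow> has_cderiv3 (f n) (D n p) p"
    and bound: "\<And>n p. p \<in> ball 0 \<rho> \<Longrightarrow> norm (f n p) \<le> (1/2) ^ n" and p: "p \<in> ball 0 (\<rho>/2)"
  shows "has_cderiv3 (\<lambda>p. \<Sum>n. f n p) (\<lambda>h. \<Sum>n. D n p h) p"
proof -
  let ?S = "ball (0::complex3) (\<rho>/2)"
  define K where "K = 4 / \<rho>"
  have K: "K > 0" using \<rho> by (simp add: K_def)
  have sub: "ball q (\<rho>/2) \<subseteq> ball 0 \<rho>" if "q \<in> ?S" for q
    using that by (auto simp: subset_iff dist_norm) (smt (verit) norm_triangle_ineq4 norm_minus_commute norm_triangle_sub)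
  have Dle: "norm (D n q h) \<le> K * norm h * (1/2) ^ n" if "q \<in> ?S" for n q h
  proof -
    have "q \<in> ball 0 \<rho>" using that \<rho> by auto
    then have "norm (D n q h) \<le> 2 * (1/2) ^ n / (\<rho>/2) * norm h"
      by (intro Cauchy_estimate3[of "\<rho>/2" q "f n"])
        (use \<rho> in simp, use D sub[OF that] in blast, use bound sub[OF that] in blast, use D in blast)
    then show ?thesis by (simp add: K_def field_simps)
  qed
  have summD: "summable (\<lambda>n. D n q h)" if "q \<in> ?S" for q h
    by (rule summable_comparison_test'[of "\<lambda>n. K * norm h * (1/2) ^ n" 0])
      (use Dle[OF that] in \<open>auto intro!: summable_mult summable_geometric\<close>)
  have tail: "norm (sum (\<lambda>i. D i q h) {..<n} - (\<Sum>i. D i q h)) \<le> 2 * K * (1/2) ^ n * norm h"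
    if "q \<in> ?S" for n q h
  proof -
    have sg: "summable (\<lambda>i. K * norm h * (1/2) ^ (i + n))"
      by (auto intro!: summable_mult summable_ignore_initial_segment summable_geometric)
    have "norm (sum (\<lambda>i. D i q h) {..<n} - (\<Sum>i. D i q h)) = norm (\<Sum>i. D (i + n) q h)"
      using suminf_split_initial_segment[OF summD[OF that], of h n]
      by (simp add: norm_minus_commute)
    also have "\<dots> \<le> (\<Sum>i. K * norm h * (1/2) ^ (i + n))"
      by (rule norm_suminf_le[OF _ sg]) (use Dle[OF that] in simp)
    also have "\<dots> = K * norm h * (1/2) ^ n * (\<Sum>i. (1/2) ^ i)"
      by (subst suminf_mult[symmetric]) (auto simp: power_add mult_ac intro: summable_geometric)
    also have "\<dots> = 2 * K * (1/2) ^ n * norm h"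
      by (simp add: suminf_geometric)
    finally show ?thesis .
  qed
  have summf: "summable (\<lambda>n. f n q)" if "q \<in> ball 0 \<rho>" for q
    by (rule summable_comparison_test'[of "\<lambda>n. (1/2) ^ n" 0])
      (use bound[OF that] in \<open>auto intro!: summable_geometric\<close>)
  have pin: "p \<in> ball 0 \<rho>" using p \<rho> by auto
  have "\<exists>g. \<forall>q\<in>?S. (\<lambda>n. f n q) sums g q \<and> (g has_derivative (\<lambda>h. \<Sum>n. D n q h)) (at q within ?S)"
  proof (rule has_derivative_series[where l = "\<Sum>n. f n p" and x = p])
    show "(f n has_derivative D n q) (at q within ?S)" if "q \<in> ?S" for n q
      using D[of q n] that \<rho> by (auto simp: has_cderiv3_def intro: has_derivative_at_withinI)
    show "\<forall>\<^sub>F n in sequentially. \<forall>q\<in>?S. \<forall>h.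
        norm (sum (\<lambda>i. D i q h) {..<n} - (\<Sum>i. D i q h)) \<le> e * norm h" if e: "e > 0" for e
    proof -
      have "(\<lambda>n. 2 * K * (1/2) ^ n) \<longlonglongrightarrow> 2 * K * 0"
        by (intro tendsto_intros LIMSEQ_power_zero) auto
      then have "\<forall>\<^sub>F n in sequentially. 2 * K * (1/2) ^ n < e"
        using e by (intro order_tendstoD) auto
      then show ?thesis
        by eventually_elim (auto intro!: order_trans[OF tail] mult_right_mono)
    qed
  qed (use p summf[OF pin] in \<open>auto simp: summable_sums\<close>)
  then obtain g where g: "\<And>q. q \<in> ?S \<Longrightarrow> (\<lambda>n. f n q) sums g q"
      "\<And>q. q \<in> ?S \<Longrightarrow> (g has_derivative (\<lambda>h. \<Sum>n. D n q h)) (at q within ?S)"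
    by blast
  have "(g has_derivative (\<lambda>h. \<Sum>n. D n p h)) (at p)"
    using g(2)[OF p] p by (simp add: at_within_open[OF p])
  then have "((\<lambda>q. \<Sum>n. f n q) has_derivative (\<lambda>h. \<Sum>n. D n p h)) (at p)"
    by (rule has_derivative_transform_within_open[OF _ open_ball p]) (use g(1) in \<open>simp add: sums_iff\<close>)
  moreover have "clinear3 (\<lambda>h. \<Sum>n. D n p h)"
    using D[OF pin] summD[OF p] by (simp add: clinear3_def has_cderiv3_def suminf_mult)
  ultimately show ?thesis by (simp add: has_cderiv3_def)
qed

subsection \<open>Coefficients of the expansion at a pole\<close>

text \<open>The series \<open>1 + Y\<close> and \<open>1 + P\<close> with coefficients \<open>root_coeff\<close> and \<open>recip_coeff\<close> below stand for
  \<open>- s X\<^sub>2\<close> and its reciprocal, and \<open>forcing\<close> gives the coefficients of \<open>X\<^sub>2\<^sup>2 - 1\<close>; here \<open>k = 2 \<alpha> + 2 s\<close>.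
  Integrating the equations for \<open>z\<close> and \<open>h\<close> divides the coefficient of weight \<open>n - 3\<close> by \<open>n - 2\<close> and
  \<open>n - 4\<close> respectively.  The resonance \<open>n = 4\<close> is harmless, since \<open>P\<close> has no term of weight 1; there the
  division by zero yields 0, as does truncated subtraction for \<open>n < 3\<close>, where \<open>P\<close> contributes its
  vanishing coefficient of weight 0.\<close>

definition forcing :: "complex \<Rightarrow> complex \<Rightarrow> complex3 \<Rightarrow> nat \<Rightarrow> complex \<Rightarrow> complex" where
  "forcing s k p n b =
     (if n = 2 then fst (snd p) else 0) + (if n = 3 then k * snd (snd p) else 0) +
     (if n = 4 then fst p else 0) +
     s * snd (snd p) * (1 / (of_nat (n - 3) + 1) * b - 1 / (of_nat (n - 3) - 1) * b)"

text \<open>Both sequences are built at once because each needs the other. The open index range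
  keeps every recursive call below \<open>n\<close>; the two end terms would vanish anyway.\<close>

fun pole_coeffs :: "complex \<Rightarrow> complex \<Rightarrow> complex3 \<Rightarrow> nat \<Rightarrow> complex \<times> complex" where
  "pole_coeffs s k p n = (if n = 0 then (0, 0) else
     let y = (forcing s k p n (snd (pole_coeffs s k p (n - 3)))
            - (\<Sum>i\<in>{0<..<n}. fst (pole_coeffs s k p i) * fst (pole_coeffs s k p (n - i)))) / 2
     in (y, - y - (\<Sum>i\<in>{0<..<n}. fst (pole_coeffs s k p i) * snd (pole_coeffs s k p (n - i)))))"

declare pole_coeffs.simps [simp del]

definition root_coeff :: "complex \<Rightarrow> complex \<Rightarrow> complex3 \<Rightarrow> nat \<Rightarrow> complex" where
  "root_coeff s k p n = fst (pole_coeffs s k p n)"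

definition recip_coeff :: "complex \<Rightarrow> complex \<Rightarrow> complex3 \<Rightarrow> nat \<Rightarrow> complex" where
  "recip_coeff s k p n = snd (pole_coeffs s k p n)"

lemma coeff_0 [simp]: "root_coeff s k p 0 = 0" "recip_coeff s k p 0 = 0"
  by (simp_all add: root_coeff_def recip_coeff_def pole_coeffs.simps)

lemma sum_atMost_interior:
  fixes f :: "nat \<Rightarrow> 'a::comm_monoid_add"
  assumes "f 0 = 0" "f n = 0"
  shows "sum f {..n} = sum f {0<..<n}"
  by (rule sum.mono_neutral_right) (use assms in \<open>auto simp: not_less le_less\<close>)

text \<open>The end terms of the convolution contain a coefficient of index 0 and vanish, so the
  recursion takes the form of a Cauchy product. It is the comparison of coefficients in 2 Y + Y^2 =
  forcing.\<close>

lemma root_coeff_eq: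
  "root_coeff s k p n = (forcing s k p n (recip_coeff s k p (n - 3))
     - (\<Sum>i\<le>n. root_coeff s k p i * root_coeff s k p (n - i))) / 2"
proof (cases "n = 0")
  case True
  then show ?thesis by (simp add: forcing_def)
next
  case False
  then show ?thesis
    by (subst sum_atMost_interior) (simp_all add: root_coeff_def recip_coeff_def pole_coeffs.simps[of s k p n] Let_def pole_coeffs.simps[of s k p 0])
qed

text \<open>This is the comparison of coefficients in (1 + Y) (1 + P) = 1.\<close>

lemma recip_coeff_eq:
  "recip_coeff s k p n = - root_coeff s k p n - (\<Sum>i\<le>n. root_coeff s k p i * recip_coeff s k p (n - i))"
proof (cases "n = 0")
  case False
  then show ?thesis
    by (subst sum_atMost_interior) (simp_all add: root_coeff_def recip_coeff_def pole_coeffs.simps[of s k p n] Let_def pole_coeffs.simps[of s k p 0])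
qed simp

lemma coeff_1 [simp]: "root_coeff s k p (Suc 0) = 0" "recip_coeff s k p (Suc 0) = 0"
proof -
  show "root_coeff s k p (Suc 0) = 0"
    by (subst root_coeff_eq) (simp add: forcing_def)
  then show "recip_coeff s k p (Suc 0) = 0"
    by (subst recip_coeff_eq) simp
qed

section \<open>Majorant bounds for the coefficients\<close>

text \<open>Since the index 0 terms vanish, a nonzero product of total index at most
  \<open>Suc N\<close> has both indices at most \<open>N\<close>. This gain of one index is what
  closes the later induction on \<open>N\<close>.\<close>

lemma sum_convolution_le:
  fixes x y :: "nat \<Rightarrow> real"
  assumes "\<And>n. x n \<ge> 0" "\<And>n. y n \<ge> 0" "x 0 = 0" "y 0 = 0"
  shows "(\<Sum>n\<le>Suc N. \<Sum>i\<le>n. x i * y (n - i)) \<le> (\<Sum>i\<le>N. x i) * (\<Sum>i\<le>N. y i)"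
proof -
  let ?T = "{(i, j). i + j \<le> Suc N}" and ?f = "\<lambda>(i, j). x i * y j"
  have fin: "finite ?T"
    by (rule finite_subset[of _ "{..Suc N} \<times> {..Suc N}"]) auto
  have "(\<Sum>n\<le>Suc N. \<Sum>i\<le>n. x i * y (n - i)) = sum ?f ?T"
    by (rule sum.triangle_reindex_eq[symmetric])
  also have "\<dots> = sum ?f (?T \<inter> {..N} \<times> {..N})"
  proof (rule sum.mono_neutral_right[OF fin])
    show "\<forall>q\<in>?T - ?T \<inter> {..N} \<times> {..N}. ?f q = 0"
    proof
      fix q assume q: "q \<in> ?T - ?T \<inter> {..N} \<times> {..N}"
      obtain i j where ij: "q = (i, j)" by (cases q)
      then have "i = 0 \<or> j = 0" using q by auto
      then show "?f q = 0" using assms ij by auto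
    qed
  qed auto
  also have "\<dots> \<le> sum ?f ({..N} \<times> {..N})"
    using assms by (intro sum_mono2) auto
  also have "\<dots> = (\<Sum>i\<le>N. x i) * (\<Sum>i\<le>N. y i)"
    by (simp add: sum_product sum.cartesian_product)
  finally show ?thesis .
qed

lemma weighted_norm_convolution_le:
  fixes a b :: "nat \<Rightarrow> complex"
  shows "2 ^ n * norm (\<Sum>i\<le>n. a i * b (n - i)) \<le> (\<Sum>i\<le>n. (2 ^ i * norm (a i)) * (2 ^ (n - i) * norm (b (n - i))))"
proof -
  have "norm (\<Sum>i\<le>n. a i * b (n - i)) \<le> (\<Sum>i\<le>n. norm (a i) * norm (b (n - i)))"
    by (intro sum_norm_le) (simp add: norm_mult)
  then have "2 ^ n * norm (\<Sum>i\<le>n. a i * b (n - i)) \<le> 2 ^ n * (\<Sum>i\<le>n. norm (a i) * norm (b (n - i)))"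
    by simp
  also have "\<dots> = (\<Sum>i\<le>n. (2 ^ i * norm (a i)) * (2 ^ (n - i) * norm (b (n - i))))"
    unfolding sum_distrib_left
  proof (rule sum.cong)
    fix i assume "i \<in> {..n}"
    then have "(2::real) ^ n = 2 ^ i * 2 ^ (n - i)" by (simp flip: power_add)
    then show "2 ^ n * (norm (a i) * norm (b (n - i))) = (2 ^ i * norm (a i)) * (2 ^ (n - i) * norm (b (n - i)))"
      by simp
  qed simp
  finally show ?thesis .
qed

lemma norm_inverse_shift_le:
  "norm (1 / (of_nat m + 1 :: complex)) \<le> 1" "norm (1 / (of_nat m - 1 :: complex)) \<le> 1"
proof -
  have "of_nat m + 1 = (of_nat (Suc m) :: complex)" by simp
  then show "norm (1 / (of_nat m + 1 :: complex)) \<le> 1"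
    by (simp add: norm_divide del: of_nat_Suc)
  show "norm (1 / (of_nat m - 1 :: complex)) \<le> 1"
  proof (cases m)
    case (Suc j)
    \<comment> \<open>For \<open>j = 0\<close>, that is \<open>m = 1\<close>, the quotient is a
      division by zero with value 0; otherwise the denominator is the positive integer
      \<open>j\<close>.\<close>
    then show ?thesis by (cases "j = 0") (simp_all add: norm_divide)
  qed simp
qed

text \<open>The factors 4, 8 and 16 of the first three terms are \<open>2 ^ n\<close> at n = 2, 3,
  4. The last 16 is 8 for the index shift by 3 times 2 for the two quotients.\<close>

lemma weighted_norm_forcing_le:
  assumes s: "norm s = 1"
  shows "2 ^ n * norm (forcing s k p n b) \<le>
    (if n = 2 then 4 * norm (fst (snd p)) else 0) + (if n = 3 then 8 * norm (k * snd (snd p)) else 0) +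
    (if n = 4 then 16 * norm (fst p) else 0) + 16 * norm (snd (snd p)) * (2 ^ (n - 3) * norm b)"
proof -
  let ?c = "1 / (of_nat (n - 3) + 1) * b - 1 / (of_nat (n - 3) - 1) * b"
  have "norm ?c \<le> norm (1 / (of_nat (n - 3) + 1 :: complex)) * norm b + norm (1 / (of_nat (n - 3) - 1 :: complex)) * norm b"
    by (rule order_trans[OF norm_triangle_ineq4]) (simp only: norm_mult order_refl)
  also have "\<dots> \<le> 1 * norm b + 1 * norm b"
    by (intro add_mono mult_right_mono norm_inverse_shift_le) auto
  finally have c: "norm ?c \<le> 2 * norm b" by simp
  \<comment> \<open>Only an inequality holds, since \<open>n - 3\<close> is truncated for
    \<open>n < 3\<close>.\<close>
  have pow: "(2::real) ^ n \<le> 8 * 2 ^ (n - 3)"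
  proof -
    have "(2::real) ^ n \<le> 2 ^ (3 + (n - 3))" by (rule power_increasing) auto
    then show ?thesis by (simp add: power_add)
  qed
  have "2 ^ n * norm (s * snd (snd p) * ?c) \<le> (8 * 2 ^ (n - 3)) * (norm (snd (snd p)) * (2 * norm b))"
    using c pow s by (intro mult_mono) (auto simp: norm_mult intro: mult_left_mono)
  then have t4: "2 ^ n * norm (s * snd (snd p) * ?c) \<le> 16 * norm (snd (snd p)) * (2 ^ (n - 3) * norm b)"
    by (simp add: mult_ac)
  let ?t = "\<lambda>m z. (if n = m then z else (0::complex))"
  have "norm (forcing s k p n b) \<le> norm (?t 2 (fst (snd p))) + norm (?t 3 (k * snd (snd p)))
      + norm (?t 4 (fst p)) + norm (s * snd (snd p) * ?c)"
    unfolding forcing_def by (intro norm_triangle_le add_mono order_refl)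
  then have "2 ^ n * norm (forcing s k p n b) \<le> 2 ^ n * norm (?t 2 (fst (snd p))) + 2 ^ n * norm (?t 3 (k * snd (snd p)))
      + 2 ^ n * norm (?t 4 (fst p)) + 2 ^ n * norm (s * snd (snd p) * ?c)"
    by (simp flip: distrib_left)
  also have "\<dots> \<le> (if n = 2 then 4 * norm (fst (snd p)) else 0) + (if n = 3 then 8 * norm (k * snd (snd p)) else 0) +
    (if n = 4 then 16 * norm (fst p) else 0) + 16 * norm (snd (snd p)) * (2 ^ (n - 3) * norm b)"
    by (intro add_mono t4) auto
  finally show ?thesis .
qed

text \<open>As for convolutions, the bound must lower the range from \<open>Suc N\<close> to
  \<open>N\<close> for the induction; truncated differences only contribute
  \<open>g 0 = 0\<close>.\<close>

lemma sum_shift3_le: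
  fixes g :: "nat \<Rightarrow> real"
  assumes "\<And>n. g n \<ge> 0" "g 0 = 0"
  shows "(\<Sum>n\<le>Suc N. g (n - 3)) \<le> (\<Sum>n\<le>N. g n)"
proof -
  have shift: "(\<Sum>n<M + 3. g (n - 3)) = (\<Sum>n<M. g n)" for M
    by (induction M) (simp_all add: assms(2) numeral_3_eq_3)
  have "(\<Sum>n\<le>Suc N. g (n - 3)) \<le> (\<Sum>n<Suc N + 3. g (n - 3))"
    by (rule sum_mono2) (auto simp: assms(1))
  then show ?thesis
    by (simp only: shift lessThan_Suc_atMost)
qed

text \<open>The weights \<open>2 ^ n\<close> turn the bound into geometric decay of the single coefficients.\<close>

lemma coeff_sums_bounded:
  assumes s: "norm s = 1"
    and small: "4 * norm (fst (snd p)) + 8 * norm (k * snd (snd p)) + 16 * norm (fst p) \<le> 1/16"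
      "norm (snd (snd p)) \<le> 1/64"
  shows "(\<Sum>n\<le>N. 2 ^ n * norm (root_coeff s k p n)) \<le> 1/8 \<and> (\<Sum>n\<le>N. 2 ^ n * norm (recip_coeff s k p n)) \<le> 1/4"
proof (induction N)
  case (Suc N)
  \<comment> \<open>The pair of bounds reproduces itself: the forcing sums to at most 1/16 + 1/16 =
    1/8, then the roots to at most (1/8 + 1/64) / 2 \<le> 1/8, and the reciprocals to at most 1/8 +
    1/32 \<le> 1/4.\<close>
  define y where "y n = 2 ^ n * norm (root_coeff s k p n)" for n
  define \<pi> where "\<pi> n = 2 ^ n * norm (recip_coeff s k p n)" for n
  define \<sigma> where "\<sigma> n = 2 ^ n * norm (forcing s k p n (recip_coeff s k p (n - 3)))" for n
  have nonneg: "y n \<ge> 0" "\<pi> n \<ge> 0" for n by (simp_all add: y_def \<pi>_def)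
  have zero: "y 0 = 0" "\<pi> 0 = 0" by (simp_all add: y_def \<pi>_def)
  have IH: "sum y {..N} \<le> 1/8" "sum \<pi> {..N} \<le> 1/4"
    using Suc unfolding y_def \<pi>_def by auto
  have "sum \<sigma> {..Suc N} \<le> (\<Sum>n\<le>Suc N. (if n = 2 then 4 * norm (fst (snd p)) else 0)
      + (if n = 3 then 8 * norm (k * snd (snd p)) else 0)
      + (if n = 4 then 16 * norm (fst p) else 0) + 16 * norm (snd (snd p)) * \<pi> (n - 3))"
    unfolding \<sigma>_def \<pi>_def by (intro sum_mono weighted_norm_forcing_le[OF s])
  also have "\<dots> \<le> 4 * norm (fst (snd p)) + 8 * norm (k * snd (snd p)) + 16 * norm (fst p)
      + 16 * norm (snd (snd p)) * (\<Sum>n\<le>Suc N. \<pi> (n - 3))"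
    unfolding sum.distrib by (intro add_mono) (simp_all add: sum_distrib_left del: sum.atMost_Suc)
  also have "\<dots> \<le> 1/16 + 16 * (1/64) * (1/4)"
    using small nonneg sum_shift3_le[of \<pi> N] zero IH(2)
    by (intro add_mono mult_mono sum_nonneg) auto
  finally have \<sigma>: "sum \<sigma> {..Suc N} \<le> 1/8" by simp
  have "y n \<le> (\<sigma> n + (\<Sum>i\<le>n. y i * y (n - i))) / 2" for n
  proof -
    have "2 ^ n * norm (root_coeff s k p n) \<le> 2 ^ n * ((norm (forcing s k p n (recip_coeff s k p (n - 3)))
        + norm (\<Sum>i\<le>n. root_coeff s k p i * root_coeff s k p (n - i))) / 2)"
      by (subst root_coeff_eq) (auto simp: norm_divide intro!: norm_triangle_ineq4)
    with weighted_norm_convolution_le[where a = "root_coeff s k p" and b = "root_coeff s k p" and n = n]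
    show ?thesis by (simp add: y_def \<sigma>_def distrib_left)
  qed
  then have "sum y {..Suc N} \<le> (\<Sum>n\<le>Suc N. (\<sigma> n + (\<Sum>i\<le>n. y i * y (n - i))) / 2)"
    by (rule sum_mono)
  also have "\<dots> = (sum \<sigma> {..Suc N} + (\<Sum>n\<le>Suc N. \<Sum>i\<le>n. y i * y (n - i))) / 2"
    by (simp only: sum.distrib sum_divide_distrib[symmetric])
  also have "\<dots> \<le> (1/8 + sum y {..N} * sum y {..N}) / 2"
    by (intro divide_right_mono add_mono \<sigma> sum_convolution_le nonneg zero) simp
  also have "\<dots> \<le> (1/8 + 1/8 * (1/8)) / 2"
    by (intro divide_right_mono add_mono mult_mono IH sum_nonneg nonneg) auto
  finally have y: "sum y {..Suc N} \<le> 1/8" by simp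
  have "\<pi> n \<le> y n + (\<Sum>i\<le>n. y i * \<pi> (n - i))" for n
  proof -
    have "2 ^ n * norm (recip_coeff s k p n) \<le> 2 ^ n * (norm (root_coeff s k p n)
        + norm (\<Sum>i\<le>n. root_coeff s k p i * recip_coeff s k p (n - i)))"
      by (subst recip_coeff_eq) (auto intro!: order_trans[OF norm_triangle_ineq4])
    with weighted_norm_convolution_le[where a = "root_coeff s k p" and b = "recip_coeff s k p" and n = n]
    show ?thesis by (simp add: y_def \<pi>_def distrib_left)
  qed
  then have "sum \<pi> {..Suc N} \<le> (\<Sum>n\<le>Suc N. y n + (\<Sum>i\<le>n. y i * \<pi> (n - i)))"
    by (rule sum_mono)
  also have "\<dots> = sum y {..Suc N} + (\<Sum>n\<le>Suc N. \<Sum>i\<le>n. y i * \<pi> (n - i))"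
    by (simp only: sum.distrib)
  also have "\<dots> \<le> 1/8 + sum y {..N} * sum \<pi> {..N}"
    by (intro add_mono y sum_convolution_le nonneg zero)
  also have "\<dots> \<le> 1/8 + 1/8 * (1/4)"
    by (intro add_mono mult_mono IH sum_nonneg nonneg) auto
  finally have "sum \<pi> {..Suc N} \<le> 1/4" by simp
  with y show ?case unfolding y_def \<pi>_def by blast
qed simp

lemma coeff_bound:
  assumes "norm s = 1"
    and "4 * norm (fst (snd p)) + 8 * norm (k * snd (snd p)) + 16 * norm (fst p) \<le> 1/16"
      "norm (snd (snd p)) \<le> 1/64"
  shows "norm (root_coeff s k p n) \<le> (1/2) ^ n" "norm (recip_coeff s k p n) \<le> (1/2) ^ n"
proof -
  have *: "x \<le> (1/2) ^ n" if "2 ^ n * x \<le> c" "c \<le> 1" for x c :: real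
    using that by (simp add: field_simps)
  show "norm (root_coeff s k p n) \<le> (1/2) ^ n"
    using coeff_sums_bounded[OF assms, of n]
      member_le_sum[of n "{..n}" "\<lambda>n. 2 ^ n * norm (root_coeff s k p n)"]
    by (intro *[of _ "1/8"]) auto
  show "norm (recip_coeff s k p n) \<le> (1/2) ^ n"
    using coeff_sums_bounded[OF assms, of n]
      member_le_sum[of n "{..n}" "\<lambda>n. 2 ^ n * norm (recip_coeff s k p n)"]
    by (intro *[of _ "1/4"]) auto
qed

subsection \<open>Weighted homogeneity and convergence\<close>

text \<open>The infinitesimal form of weighted homogeneity, with weights 4, 2, 3, is stable under the recursion
  and carries over to the sums term by term.\<close>

definition euler3 :: "complex3 \<Rightarrow> complex3" where
  "euler3 p = (4 * fst p, 2 * fst (snd p), 3 * snd (snd p))"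

definition weighted_homogeneous :: "nat \<Rightarrow> (complex3 \<Rightarrow> complex) \<Rightarrow> bool" where
  "weighted_homogeneous n f \<longleftrightarrow> (\<forall>p. \<exists>D. has_cderiv3 f D p \<and> D (euler3 p) = of_nat n * f p)"

lemma weighted_homogeneous_zero: "weighted_homogeneous n (\<lambda>p. 0)"
  unfolding weighted_homogeneous_def
  by (intro allI exI conjI, rule has_cderiv3_const) simp

lemma weighted_homogeneous_coord:
  "weighted_homogeneous 4 fst" "weighted_homogeneous 2 (\<lambda>p. fst (snd p))"
  "weighted_homogeneous 3 (\<lambda>p. snd (snd p))"
  unfolding weighted_homogeneous_def
  by (intro allI exI conjI, rule has_cderiv3_coord, simp add: euler3_def)+

lemma weighted_homogeneous_add:
  assumes "weighted_homogeneous n f" "weighted_homogeneous n g"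
  shows "weighted_homogeneous n (\<lambda>p. f p + g p)"
  unfolding weighted_homogeneous_def
proof
  fix p
  obtain D E where "has_cderiv3 f D p" "D (euler3 p) = of_nat n * f p"
      "has_cderiv3 g E p" "E (euler3 p) = of_nat n * g p"
    using assms unfolding weighted_homogeneous_def by metis
  then show "\<exists>D. has_cderiv3 (\<lambda>p. f p + g p) D p \<and> D (euler3 p) = of_nat n * (f p + g p)"
    by (intro exI[of _ "\<lambda>h. D h + E h"]) (simp add: has_cderiv3_add distrib_left)
qed

lemma weighted_homogeneous_cmult:
  assumes "weighted_homogeneous n f"
  shows "weighted_homogeneous n (\<lambda>p. c * f p)"
  unfolding weighted_homogeneous_def
proof
  fix p
  obtain D where "has_cderiv3 f D p" "D (euler3 p) = of_nat n * f p"
    using assms unfolding weighted_homogeneous_def by metis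
  then show "\<exists>D. has_cderiv3 (\<lambda>p. c * f p) D p \<and> D (euler3 p) = of_nat n * (c * f p)"
    by (intro exI[of _ "\<lambda>h. c * D h"]) (simp add: has_cderiv3_cmult)
qed

lemma weighted_homogeneous_diff:
  assumes "weighted_homogeneous n f" "weighted_homogeneous n g"
  shows "weighted_homogeneous n (\<lambda>p. f p - g p)"
  using weighted_homogeneous_add[OF assms(1) weighted_homogeneous_cmult[OF assms(2), of "-1"]] by simp

lemma weighted_homogeneous_mult:
  assumes "weighted_homogeneous m f" "weighted_homogeneous n g"
  shows "weighted_homogeneous (m + n) (\<lambda>p. f p * g p)"
  unfolding weighted_homogeneous_def
proof
  fix p
  obtain D E where "has_cderiv3 f D p" "D (euler3 p) = of_nat m * f p"
      "has_cderiv3 g E p" "E (euler3 p) = of_nat n * g p"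
    using assms unfolding weighted_homogeneous_def by metis
  then show "\<exists>D. has_cderiv3 (\<lambda>p. f p * g p) D p \<and> D (euler3 p) = of_nat (m + n) * (f p * g p)"
    by (intro exI[of _ "\<lambda>h. f p * E h + D h * g p"] conjI has_cderiv3_mult) (simp_all add: algebra_simps)
qed

lemma weighted_homogeneous_sum:
  assumes "\<And>i. i \<in> I \<Longrightarrow> weighted_homogeneous n (f i)"
  shows "weighted_homogeneous n (\<lambda>p. \<Sum>i\<in>I. f i p)"
  using assms
  by (induction I rule: infinite_finite_induct)
    (simp_all add: weighted_homogeneous_zero weighted_homogeneous_add)

text \<open>The Euler field vanishes at the origin, so \<open>n\<close> times the value there is a
  linear map evaluated at 0.\<close>

lemma weighted_homogeneous_at_0:
  assumes "weighted_homogeneous n f" "n > 0"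
  shows "f 0 = 0"
proof -
  obtain D where D: "has_cderiv3 f D 0" "D (euler3 0) = of_nat n * f 0"
    using assms unfolding weighted_homogeneous_def by metis
  moreover have "D 0 = 0"
    using D(1) by (auto simp: has_cderiv3_def intro: linear_0 has_derivative_linear)
  ultimately show ?thesis
    using assms(2) by (simp add: euler3_def flip: zero_prod_def)
qed

text \<open>The second hypothesis handles \<open>n < 3\<close>: there truncation gives
  \<open>f\<close> weight 0, and its product with the third coordinate would have weight 3 instead
  of \<open>n\<close>.\<close>

lemma weighted_homogeneous_forcing:
  assumes "weighted_homogeneous (n - 3) f" "n < 3 \<Longrightarrow> f = (\<lambda>p. 0)"
  shows "weighted_homogeneous n (\<lambda>p. forcing s k p n (f p))"
proof -
  have last: "weighted_homogeneous n (\<lambda>p. s * snd (snd p) * (1 / (of_nat (n - 3) + 1) * f p - 1 / (of_nat (n - 3) - 1) * f p))"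
  proof (cases "n < 3")
    case True
    then show ?thesis using assms(2) weighted_homogeneous_zero by simp
  next
    case False
    then have n: "n = 3 + (n - 3)" by simp
    show ?thesis
      by (subst n) (intro weighted_homogeneous_mult weighted_homogeneous_diff weighted_homogeneous_cmult
          weighted_homogeneous_coord assms(1))
  qed
  have if_rule: "weighted_homogeneous n (\<lambda>p. if n = m then g p else 0)" if "weighted_homogeneous m g" for m g
    using that weighted_homogeneous_zero by (cases "n = m") simp_all
  show ?thesis
    unfolding forcing_def
    by (intro weighted_homogeneous_add if_rule last weighted_homogeneous_cmult weighted_homogeneous_coord)
qed

lemma weighted_homogeneous_coeff:
  "weighted_homogeneous n (\<lambda>p. root_coeff s k p n) \<and> weighted_homogeneous n (\<lambda>p. recip_coeff s k p n)"
proof (induction n rule: less_induct)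
  case (less n)
  show ?case
  proof (cases "n = 0")
    case True
    then show ?thesis by (simp add: weighted_homogeneous_zero)
  next
    case False
    have product: "weighted_homogeneous n (\<lambda>p. \<Sum>i\<le>n. root_coeff s k p i * g p (n - i))"
      if g: "\<And>m. m < n \<Longrightarrow> weighted_homogeneous m (\<lambda>p. g p m)" "\<And>p. g p 0 = 0" for g
    proof (rule weighted_homogeneous_sum)
      fix i assume i: "i \<in> {..n}"
      \<comment> \<open>In the two end terms one factor has weight \<open>n\<close>, which the
        induction hypothesis does not reach, but the other factor is the vanishing coefficient of
        index 0.\<close>
      show "weighted_homogeneous n (\<lambda>p. root_coeff s k p i * g p (n - i))"
      proof (cases "i = 0 \<or> i = n")
        case True
        then show ?thesis
          by (elim disjE) (simp_all add: g(2) weighted_homogeneous_zero del: split_paired_All)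
      next
        case False
        then have "weighted_homogeneous (i + (n - i)) (\<lambda>p. root_coeff s k p i * g p (n - i))"
          using i less by (intro weighted_homogeneous_mult g(1)) auto
        then show ?thesis using i by simp
      qed
    qed
    have "weighted_homogeneous n (\<lambda>p. forcing s k p n (recip_coeff s k p (n - 3)))"
      using less[of "n - 3"] False by (intro weighted_homogeneous_forcing) auto
    then have "weighted_homogeneous n (\<lambda>p. 1/2 * (forcing s k p n (recip_coeff s k p (n - 3))
         - (\<Sum>i\<le>n. root_coeff s k p i * root_coeff s k p (n - i))))"
      using less by (intro weighted_homogeneous_cmult weighted_homogeneous_diff product) auto
    then have root: "weighted_homogeneous n (\<lambda>p. root_coeff s k p n)"
      by (subst root_coeff_eq) simp
    then have "weighted_homogeneous n (\<lambda>p. (-1) * root_coeff s k p n -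
        (\<Sum>i\<le>n. root_coeff s k p i * recip_coeff s k p (n - i)))"
      using less by (intro weighted_homogeneous_cmult weighted_homogeneous_diff product) auto
    then have "weighted_homogeneous n (\<lambda>p. recip_coeff s k p n)"
      by (subst recip_coeff_eq) simp
    with root show ?thesis by blast
  qed
qed

section \<open>Convergent sums and their differential identities\<close>

text \<open>The Euler derivative multiplies the term of weight \<open>n\<close> by \<open>n\<close>.
  Coefficients divided by \<open>n + 1\<close> or \<open>n - 1\<close> thus become solutions of
  first order equations along the Euler field.\<close>

lemma suminf_weighted_homogeneous:
  assumes \<rho>: "\<rho> > 0" and f: "\<And>n. weighted_homogeneous n (f n)"
    and bound: "\<And>n p. p \<in> ball 0 \<rho> \<Longrightarrow> norm (f n p) \<le> (1/2) ^ n" and p: "p \<in> ball 0 (\<rho>/2)"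
  shows "\<exists>D. has_cderiv3 (\<lambda>p. \<Sum>n. f n p) D p \<and> D (euler3 p) = (\<Sum>n. of_nat n * f n p)"
proof -
  obtain D where D: "\<And>n p. has_cderiv3 (f n) (D n p) p \<and> D n p (euler3 p) = of_nat n * f n p"
    using f unfolding weighted_homogeneous_def by metis
  then have "has_cderiv3 (\<lambda>p. \<Sum>n. f n p) (\<lambda>h. \<Sum>n. D n p h) p"
    using bound by (intro has_cderiv3_suminf[OF \<rho> _ _ p]) auto
  moreover have "(\<Sum>n. D n p (euler3 p)) = (\<Sum>n. of_nat n * f n p)"
    using D by simp
  ultimately show ?thesis by blast
qed

text \<open>In the notation of the beginning, \<open>z \<lambda>\<^sup>2 = v + s e (1 + A)\<close> and \<open>h \<lambda>\<^sup>4 = u - s e B\<close>.\<close>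

definition pole_functions ::
    "complex \<Rightarrow> complex \<Rightarrow> (complex3 \<Rightarrow> complex) \<Rightarrow> (complex3 \<Rightarrow> complex) \<Rightarrow>
     (complex3 \<Rightarrow> complex) \<Rightarrow> (complex3 \<Rightarrow> complex) \<Rightarrow> complex3 \<Rightarrow> bool" where
  "pole_functions s k Y P A B p \<longleftrightarrow>
     (1 + Y p) * (1 + P p) = 1 \<and>
     (1 + Y p)\<^sup>2 = 1 + fst p + fst (snd p) + k * snd (snd p) + s * snd (snd p) * (A p - B p) \<and>
     (\<exists>D. has_cderiv3 Y D p) \<and>
     (\<exists>D. has_cderiv3 A D p \<and> D (euler3 p) = P p - A p) \<and>
     (\<exists>D. has_cderiv3 B D p \<and> D (euler3 p) = P p + B p)"

lemma pole_functions_exist: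
  fixes s k :: complex
  assumes s: "norm s = 1"
  obtains \<rho> Y P A B where "\<rho> > 0" "Y 0 = 0" "A 0 = 0" "B 0 = 0"
    "\<And>p. p \<in> ball 0 \<rho> \<Longrightarrow> pole_functions s k Y P A B p"
proof -
  \<comment> \<open>If all coordinates are at most \<open>r\<close>, the first smallness condition
    of \<open>coeff_bound\<close> reads 20 r + 8 |k| r \<le> 1/16, where 20 = 4 + 16;
    \<open>r\<close> gives equality. The second condition follows from 20 r \<le> 1/16.\<close>
  define r where "r = 1 / (16 * (20 + 8 * norm k))"
  have r: "r > 0" by (simp add: r_def add_pos_nonneg)
  have rk: "r * (20 + 8 * norm k) = 1/16"
  proof -
    have "20 + 8 * norm k \<noteq> 0" using norm_ge_zero[of k] by linarith
    then show ?thesis unfolding r_def by simp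
  qed
  have "r * 20 \<le> r * (20 + 8 * norm k)" using r by (intro mult_left_mono) auto
  then have r64: "r \<le> 1/64" using rk by simp
  let ?Y = "\<lambda>n p. root_coeff s k p n" and ?P = "\<lambda>n p. recip_coeff s k p n"
  \<comment> \<open>After the shift from \<open>n - 3\<close> to \<open>n\<close>, the two quotients
    in \<open>forcing\<close> are the terms of these series.\<close>
  let ?A = "\<lambda>n p. 1 / (of_nat n + 1) * recip_coeff s k p n" and ?B = "\<lambda>n p. 1 / (of_nat n - 1) * recip_coeff s k p n"
  have bound: "norm (?Y n p) \<le> (1/2) ^ n" "norm (?P n p) \<le> (1/2) ^ n" if "p \<in> ball 0 r" for n p
  proof -
    have p: "norm p < r" using that by simp
    have c: "norm (fst p) \<le> norm p" "norm (fst (snd p)) \<le> norm p" "norm (snd (snd p)) \<le> norm p"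
      using norm_fst_le[of "fst p" "snd p"] norm_snd_le[of "snd p" "fst p"]
        norm_fst_le[of "fst (snd p)" "snd (snd p)"] norm_snd_le[of "snd (snd p)" "fst (snd p)"]
      by simp_all
    have "4 * norm (fst (snd p)) + 8 * norm (k * snd (snd p)) + 16 * norm (fst p)
        \<le> 4 * r + 8 * (norm k * r) + 16 * r"
      using p c mult_left_mono[of "norm (snd (snd p))" r "norm k"] by (simp add: norm_mult)
    also have "\<dots> = 1/16" using rk by (simp add: algebra_simps)
    finally have a: "4 * norm (fst (snd p)) + 8 * norm (k * snd (snd p)) + 16 * norm (fst p) \<le> 1/16" .
    have b: "norm (snd (snd p)) \<le> 1/64" using c p r64 by linarith
    show "norm (?Y n p) \<le> (1/2) ^ n" "norm (?P n p) \<le> (1/2) ^ n"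
      by (rule coeff_bound[OF s a b])+
  qed
  have boundAB: "norm (?A n p) \<le> (1/2) ^ n" "norm (?B n p) \<le> (1/2) ^ n" if "p \<in> ball 0 r" for n p
  proof -
    have *: "norm (c * z) \<le> (1/2) ^ n" if "norm c \<le> 1" "norm z \<le> (1/2) ^ n" for c z :: complex
      using mult_mono[OF that] by (simp add: norm_mult)
    show "norm (?A n p) \<le> (1/2) ^ n" "norm (?B n p) \<le> (1/2) ^ n"
      by (intro * norm_inverse_shift_le bound that)+
  qed
  have hom: "weighted_homogeneous n (?Y n)" "weighted_homogeneous n (?P n)"
    "weighted_homogeneous n (?A n)" "weighted_homogeneous n (?B n)" for n
    by (intro weighted_homogeneous_cmult weighted_homogeneous_coeff[THEN conjunct1]
        weighted_homogeneous_coeff[THEN conjunct2])+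
  have summ: "summable (\<lambda>n. norm (f n))" if "\<And>n. norm (f n) \<le> (1/2) ^ n" for f :: "nat \<Rightarrow> complex"
    by (rule summable_comparison_test'[of "\<lambda>n. (1/2) ^ n" 0])
      (use that in \<open>auto intro!: summable_geometric\<close>)
  define Y where "Y p = (\<Sum>n. ?Y n p)" for p
  define P where "P p = (\<Sum>n. ?P n p)" for p
  define A where "A p = (\<Sum>n. ?A n p)" for p
  define B where "B p = (\<Sum>n. ?B n p)" for p
  have zero: "?Y n 0 = 0" "?P n 0 = 0" for n
    using weighted_homogeneous_at_0[OF hom(1)[of n]] weighted_homogeneous_at_0[OF hom(2)[of n]]
    by (cases "n = 0"; simp)+
  show thesis
  \<comment> \<open>Termwise differentiation costs half of the radius \<open>r\<close>.\<close>
  proof (rule that[of "r/2" Y A B P])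
    show "r/2 > 0" using r by simp
    show "Y 0 = 0" "A 0 = 0" "B 0 = 0" by (simp_all add: Y_def A_def B_def zero)
    fix p :: complex3
    assume p: "p \<in> ball 0 (r/2)"
    then have p': "p \<in> ball 0 r" using r by auto
    note abs = summ[OF bound(1)[OF p']] summ[OF bound(2)[OF p']] summ[OF boundAB(1)[OF p']] summ[OF boundAB(2)[OF p']]
    note sums = abs[THEN summable_norm_cancel, THEN summable_sums]
    have YY: "(\<lambda>n. \<Sum>i\<le>n. ?Y i p * ?Y (n - i) p) sums (Y p * Y p)"
      unfolding Y_def by (rule Cauchy_product_sums[OF abs(1) abs(1)])
    have YP: "(\<lambda>n. \<Sum>i\<le>n. ?Y i p * ?P (n - i) p) sums (Y p * P p)"
      unfolding Y_def P_def by (rule Cauchy_product_sums[OF abs(1) abs(2)])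
    have "(\<lambda>n. ?P n p) sums (- Y p - Y p * P p)"
      by (subst recip_coeff_eq) (intro sums_diff sums_minus YP sums[folded Y_def])
    then have PY: "P p = - Y p - Y p * P p"
      unfolding P_def by (simp add: sums_iff)
    \<comment> \<open>Truncated subtraction makes the first three terms equal to
      \<open>f 0 = 0\<close>, so shifting does not change the sum.\<close>
    have sh: "(\<lambda>n. f (n - 3)) sums l" if "f sums l" "f 0 = 0" for f :: "nat \<Rightarrow> complex" and l
      using that sums_iff_shift[of "\<lambda>n. f (n - 3)" 3 l] by (simp add: numeral_3_eq_3)
    have one: "(\<lambda>n. if n = m then c else 0) sums c" for m and c :: complex
      using sums_single[of m "\<lambda>_. c"] by simp
    have forcing_sums: "(\<lambda>n. forcing s k p n (?P (n - 3) p)) sums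
        (fst (snd p) + k * snd (snd p) + fst p + s * snd (snd p) * (A p - B p))"
      unfolding forcing_def
      by (intro sums_add one sums_mult sums_diff sh[of "\<lambda>n. ?A n p"] sh[of "\<lambda>n. ?B n p"])
        (use sums in \<open>simp_all add: A_def B_def\<close>)
    have "(\<lambda>n. ?Y n p) sums ((fst (snd p) + k * snd (snd p) + fst p + s * snd (snd p) * (A p - B p) - Y p * Y p) / 2)"
      by (subst root_coeff_eq) (intro sums_divide sums_diff YY forcing_sums)
    then have YS: "Y p = (fst (snd p) + k * snd (snd p) + fst p + s * snd (snd p) * (A p - B p) - Y p * Y p) / 2"
      unfolding Y_def by (simp add: sums_iff)
    have DY: "\<exists>D. has_cderiv3 Y D p"
      unfolding Y_def using suminf_weighted_homogeneous[of r ?Y p, OF r hom(1) bound(1) p] by blast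
    have A_eq: "of_nat n * ?A n p = ?P n p - ?A n p" for n
    proof -
      have "of_nat n + 1 \<noteq> (0::complex)" using of_nat_neq_0[of n] by (simp add: add.commute)
      then show ?thesis by (simp add: field_simps)
    qed
    \<comment> \<open>The resonance is \<open>n = 1\<close>: the quotient is 0 by division by zero,
      and the identity survives because the reciprocal series has no term of weight 1.\<close>
    have B_eq: "of_nat n * ?B n p = ?P n p + ?B n p" for n
    proof (cases "n = 1")
      case False
      then have "of_nat n - 1 \<noteq> (0::complex)" by simp
      then show ?thesis by (simp add: field_simps)
    qed simp
    have "(\<Sum>n. of_nat n * ?A n p) = P p - A p"
      unfolding A_eq P_def A_def using sums by (intro suminf_diff[symmetric]) (auto simp: sums_iff)
    then have DA: "\<exists>D. has_cderiv3 A D p \<and> D (euler3 p) = P p - A p"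
      using suminf_weighted_homogeneous[of r ?A p, OF r hom(3) boundAB(1) p] unfolding A_def by simp
    have "(\<Sum>n. of_nat n * ?B n p) = P p + B p"
      unfolding B_eq P_def B_def using sums by (intro suminf_add[symmetric]) (auto simp: sums_iff)
    then have DB: "\<exists>D. has_cderiv3 B D p \<and> D (euler3 p) = P p + B p"
      using suminf_weighted_homogeneous[of r ?B p, OF r hom(4) boundAB(2) p] unfolding B_def by simp
    have "(1 + Y p) * (1 + P p) = 1" using PY by (simp add: algebra_simps)
    moreover have "(1 + Y p)\<^sup>2 = 1 + fst p + fst (snd p) + k * snd (snd p) + s * snd (snd p) * (A p - B p)"
      using YS by (simp add: power2_eq_square algebra_simps)
    ultimately show "pole_functions s k Y P A B p"
      unfolding pole_functions_def using DY DA DB by blast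
  qed
qed

subsection \<open>Local biholomorphic inverses\<close>

definition has_cderiv33 :: "(complex3 \<Rightarrow> complex3) \<Rightarrow> (complex3 \<Rightarrow> complex3) \<Rightarrow> complex3 \<Rightarrow> bool" where
  "has_cderiv33 \<Phi> D p \<longleftrightarrow> (\<Phi> has_derivative D) (at p) \<and> (\<forall>c h. D (cscale3 c h) = cscale3 c (D h))"

lemma has_cderiv33D:
  assumes "has_cderiv33 \<Phi> D p"
  shows "(\<Phi> has_derivative D) (at p)" "D (cscale3 c h) = cscale3 c (D h)"
  using assms unfolding has_cderiv33_def by blast+

lemma holomorphic3_on_iff:
  "holomorphic3_on \<Phi> U \<longleftrightarrow> open U \<and> (\<forall>p\<in>U. \<exists>D. has_cderiv33 \<Phi> D p)"
  by (simp add: holomorphic3_on_def has_cderiv33_def)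

lemma cscale3_coord [simp]:
  "fst (cscale3 c h) = c * fst h" "fst (snd (cscale3 c h)) = c * fst (snd h)"
  "snd (snd (cscale3 c h)) = c * snd (snd h)"
  by (cases h; simp)+

lemma has_cderiv33_diff:
  assumes "has_cderiv33 \<Phi> D p" "has_cderiv33 \<Psi> E p"
  shows "has_cderiv33 (\<lambda>q. \<Phi> q - \<Psi> q) (\<lambda>h. D h - E h) p"
  using assms unfolding has_cderiv33_def
  by (auto intro!: has_derivative_diff prod_eqI simp: right_diff_distrib simp del: split_paired_All)

lemma has_cderiv33_coord:
  assumes "has_cderiv33 \<Phi> D p"
  shows "has_cderiv3 (\<lambda>q. fst (\<Phi> q)) (\<lambda>h. fst (D h)) p"
    "has_cderiv3 (\<lambda>q. fst (snd (\<Phi> q))) (\<lambda>h. fst (snd (D h))) p"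
    "has_cderiv3 (\<lambda>q. snd (snd (\<Phi> q))) (\<lambda>h. snd (snd (D h))) p"
  using assms unfolding has_cderiv33_def has_cderiv3_def clinear3_def
  by (auto intro!: has_derivative_fst has_derivative_snd simp del: split_paired_All)

lemma has_cderiv33_Pair:
  assumes "has_cderiv3 f D p" "has_cderiv3 g E p" "has_cderiv3 k F p"
  shows "has_cderiv33 (\<lambda>q. (f q, g q, k q)) (\<lambda>h. (D h, E h, F h)) p"
  using assms unfolding has_cderiv33_def has_cderiv3_def clinear3_def
  by (auto intro!: has_derivative_Pair simp del: split_paired_All)

text \<open>The scalar estimate is used for each of the three components, whence 6 = 3 * 2.\<close>

lemma Cauchy_estimate33:
  assumes r: "r > 0" and hol: "\<And>q. q \<in> ball p r \<Longrightarrow> \<exists>D. has_cderiv33 \<Phi> D q"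
    and bound: "\<And>q. q \<in> ball p r \<Longrightarrow> norm (\<Phi> q) \<le> B" and D: "has_cderiv33 \<Phi> D p"
  shows "norm (D h) \<le> 6 * B / r * norm h"
proof -
  have c: "norm (fst x) \<le> norm x" "norm (fst (snd x)) \<le> norm x" "norm (snd (snd x)) \<le> norm x" for x :: complex3
    using norm_fst_le[of "fst x" "snd x"] norm_snd_le[of "snd x" "fst x"]
      norm_fst_le[of "fst (snd x)" "snd (snd x)"] norm_snd_le[of "snd (snd x)" "fst (snd x)"]
    by simp_all
  have "norm (fst (D h)) \<le> 2 * B / r * norm h"
    by (rule Cauchy_estimate3[OF r _ _ has_cderiv33_coord(1)[OF D]])
      (use hol has_cderiv33_coord(1) in blast, use bound c order_trans in blast)
  moreover have "norm (fst (snd (D h))) \<le> 2 * B / r * norm h"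
    by (rule Cauchy_estimate3[OF r _ _ has_cderiv33_coord(2)[OF D]])
      (use hol has_cderiv33_coord(2) in blast, use bound c order_trans in blast)
  moreover have "norm (snd (snd (D h))) \<le> 2 * B / r * norm h"
    by (rule Cauchy_estimate3[OF r _ _ has_cderiv33_coord(3)[OF D]])
      (use hol has_cderiv33_coord(3) in blast, use bound c order_trans in blast)
  ultimately show ?thesis
    using norm_complex3_le[of "D h"] by simp
qed

text \<open>The inverse function theorem needs a continuous derivative, whereas
  \<open>holomorphic3_on\<close> speaks of differentiability at each point. The difference of
  derivatives at \<open>x\<close> and \<open>p\<close> is the derivative at \<open>p\<close> of
  \<open>\<Phi> (w + (x - p)) - \<Phi> w\<close>. This function is of size O(|x - p|) by a Lipschitz
  bound, so the Cauchy estimate makes its derivative equally small.\<close>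

lemma holomorphic3_continuous_derivative:
  assumes hol: "holomorphic3_on \<Phi> W"
  obtains \<Phi>' :: "complex3 \<Rightarrow> complex3 \<Rightarrow>\<^sub>L complex3"
  where "\<And>p. p \<in> W \<Longrightarrow> has_cderiv33 \<Phi> (blinfun_apply (\<Phi>' p)) p" "continuous_on W \<Phi>'"
proof -
  have W: "open W" and ex: "\<And>p. p \<in> W \<Longrightarrow> \<exists>D. has_cderiv33 \<Phi> D p"
    using hol unfolding holomorphic3_on_iff by blast+
  have "\<exists>L. has_cderiv33 \<Phi> (blinfun_apply L) p" if p: "p \<in> W" for p
  proof -
    obtain D where D: "has_cderiv33 \<Phi> D p" using ex[OF p] by blast
    then have "bounded_linear D" unfolding has_cderiv33_def using has_derivative_bounded_linear by blast
    with D show ?thesis by (intro exI[of _ "Blinfun D"]) (simp add: bounded_linear_Blinfun_apply)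
  qed
  then obtain \<Phi>' :: "complex3 \<Rightarrow> complex3 \<Rightarrow>\<^sub>L complex3"
    where \<Phi>': "\<And>p. p \<in> W \<Longrightarrow> has_cderiv33 \<Phi> (blinfun_apply (\<Phi>' p)) p"
    by metis
  have contf: "continuous_on W \<Phi>"
    by (intro continuous_at_imp_continuous_on ballI) (rule has_derivative_continuous[OF has_cderiv33D(1)[OF \<Phi>']])
  have "isCont \<Phi>' p" if p: "p \<in> W" for p
  proof -
    obtain r0 where r0: "r0 > 0" "cball p r0 \<subseteq> W"
      using W p open_contains_cball by metis
    \<comment> \<open>Boundedness on the closed ball of radius \<open>2 * r\<close> bounds the
      derivative on the ball of radius \<open>r\<close>, which gives the Lipschitz bound there.
      Translating points within \<open>r/2\<close> of \<open>p\<close> by \<open>x - p\<close> stays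
      in that ball when \<open>x\<close> is within \<open>r/2\<close> too.\<close>
    define r where "r = r0 / 2"
    have r: "r > 0" "cball p (2 * r) \<subseteq> W" using r0 by (auto simp: r_def)
    have "bounded (\<Phi> ` cball p (2 * r))"
      using contf r(2) by (intro compact_imp_bounded compact_continuous_image) (auto intro: continuous_on_subset)
    then obtain M where M: "\<And>q. q \<in> cball p (2 * r) \<Longrightarrow> norm (\<Phi> q) \<le> M"
      unfolding bounded_iff by blast
    define K where "K = 6 * M / r"
    have near: "ball x r \<subseteq> cball p (2 * r)" if "x \<in> ball p r" for x
    proof
      fix q assume "q \<in> ball x r"
      with that show "q \<in> cball p (2 * r)" using dist_triangle[of p q x] by simp
    qed
    have D_le: "norm (\<Phi>' x h) \<le> K * norm h" if "x \<in> ball p r" for x h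
    proof -
      have "x \<in> W" using that r by auto
      then show ?thesis
        unfolding K_def using near[OF that] r
        by (intro Cauchy_estimate33[of r x \<Phi>] \<Phi>') (use ex M in blast)+
    qed
    have Lip: "norm (\<Phi> x - \<Phi> y) \<le> K * norm (x - y)" if "x \<in> ball p r" "y \<in> ball p r" for x y
    proof (rule differentiable_bound[where S = "ball p r" and f' = "\<lambda>x. blinfun_apply (\<Phi>' x)"])
      fix z assume z: "z \<in> ball p r"
      then have "z \<in> W" using r by auto
      then show "(\<Phi> has_derivative blinfun_apply (\<Phi>' z)) (at z within ball p r)"
        by (rule has_derivative_at_withinI[OF has_cderiv33D(1)[OF \<Phi>']])
      show "onorm (blinfun_apply (\<Phi>' z)) \<le> K"
        using D_le[OF z] by (rule onorm_le)
    qed (use that in auto)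
    have close: "norm (\<Phi>' x - \<Phi>' p) \<le> 6 * (K * norm (x - p)) / (r/2)" if x: "x \<in> ball p (r/2)" for x
    proof (rule norm_blinfun_bound)
      have K0: "0 \<le> K * norm (x - p)"
        using order_trans[OF norm_ge_zero Lip[of x p]] x r(1) by simp
      then show "0 \<le> 6 * (K * norm (x - p)) / (r/2)" using r(1) by simp
      let ?G = "\<lambda>w. \<Phi> (w + (x - p)) - \<Phi> w"
      have inb: "w + (x - p) \<in> ball p r" "w \<in> ball p r" if "w \<in> ball p (r/2)" for w
      proof -
        have "norm ((p - w) - (x - p)) \<le> norm (p - w) + norm (x - p)" by (rule norm_triangle_ineq4)
        then show "w + (x - p) \<in> ball p r" using that x by (simp add: dist_norm norm_minus_commute algebra_simps)
        show "w \<in> ball p r" using that r by simp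
      qed
      have der: "has_cderiv33 ?G (\<lambda>h. \<Phi>' (w + (x - p)) h - \<Phi>' w h) w" if w: "w \<in> ball p (r/2)" for w
      proof (rule has_cderiv33_diff)
        have W1: "w + (x - p) \<in> W" "w \<in> W" using inb[OF w] r by auto
        have "((\<lambda>w. w + (x - p)) has_derivative (\<lambda>h. h)) (at w)"
          by (auto intro!: derivative_eq_intros)
        from has_derivative_compose[OF this has_cderiv33D(1)[OF \<Phi>'[OF W1(1)]]]
        show "has_cderiv33 (\<lambda>w. \<Phi> (w + (x - p))) (blinfun_apply (\<Phi>' (w + (x - p)))) w"
          using has_cderiv33D(2)[OF \<Phi>'[OF W1(1)]] unfolding has_cderiv33_def by blast
        show "has_cderiv33 \<Phi> (blinfun_apply (\<Phi>' w)) w" by (rule \<Phi>'[OF W1(2)])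
      qed
      have pin: "p \<in> ball p (r/2)" using r by simp
      show "norm (blinfun_apply (\<Phi>' x - \<Phi>' p) h) \<le> 6 * (K * norm (x - p)) / (r/2) * norm h" for h
      proof -
        have "norm (\<Phi>' (p + (x - p)) h - \<Phi>' p h) \<le> 6 * (K * norm (x - p)) / (r/2) * norm h"
        proof (rule Cauchy_estimate33[OF _ _ _ der[OF pin]])
          show "norm (?G q) \<le> K * norm (x - p)" if "q \<in> ball p (r/2)" for q
            using Lip[OF inb[OF that]] by simp
          show "\<exists>D. has_cderiv33 ?G D q" if "q \<in> ball p (r/2)" for q
            using der[OF that] by blast
        qed (use r in simp)
        then show ?thesis by (simp add: blinfun.diff_left)
      qed
    qed
    have ev: "\<forall>\<^sub>F x in at p. norm (\<Phi>' x - \<Phi>' p) \<le> 6 * (K * norm (x - p)) / (r/2)"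
      using close r(1) by (auto simp: eventually_at dist_commute intro!: exI[of _ "r/2"])
    have "((\<lambda>x. 6 * (K * norm (x - p)) / (r/2)) \<longlongrightarrow> 6 * (K * norm (p - p)) / (r/2)) (at p)"
      by (intro tendsto_intros) (use r in auto)
    then have "((\<lambda>x. \<Phi>' x - \<Phi>' p) \<longlongrightarrow> 0) (at p)"
      by (intro Lim_null_comparison[OF ev]) simp
    then show ?thesis by (simp add: isCont_def Lim_null[symmetric])
  qed
  then have "continuous_on W \<Phi>'" by (intro continuous_at_imp_continuous_on) auto
  with \<Phi>' that show thesis by blast
qed

text \<open>The real inverse function theorem provides the inverse; its derivative is complex linear
  as the inverse of a complex linear bijection. The last conclusion later pulls vector fields back
  along \<open>\<Psi>\<close>.\<close>

lemma holomorphic3_local_inverse: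
  assumes hol: "holomorphic3_on \<Psi> W" and P: "P \<in> W" "\<Psi> P = P" "(\<Psi> has_derivative (\<lambda>h. h)) (at P)"
  obtains U \<Phi> where "P \<in> U" "biholomorphic3_on \<Phi> U" "\<Phi> P = P"
    "\<And>q. q \<in> U \<Longrightarrow> \<Phi> q \<in> W" "\<And>q. q \<in> U \<Longrightarrow> \<Psi> (\<Phi> q) = q"
    "\<And>q D. q \<in> U \<Longrightarrow> (\<Psi> has_derivative D) (at (\<Phi> q)) \<Longrightarrow> \<exists>D'. has_cderiv33 \<Phi> D' q \<and> (\<forall>h. D' (D h) = h)"
proof -
  obtain \<Psi>' :: "complex3 \<Rightarrow> complex3 \<Rightarrow>\<^sub>L complex3"
    where \<Psi>': "\<And>p. p \<in> W \<Longrightarrow> has_cderiv33 \<Psi> (blinfun_apply (\<Psi>' p)) p" and cont: "continuous_on W \<Psi>'"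
    using holomorphic3_continuous_derivative[OF hol] by blast
  have W: "open W" using hol by (simp add: holomorphic3_on_def)
  have "blinfun_apply (\<Psi>' P) = (\<lambda>h. h)"
    by (rule has_derivative_unique[OF has_cderiv33D(1)[OF \<Psi>'[OF P(1)]] P(3)])
  then have id: "id_blinfun o\<^sub>L \<Psi>' P = id_blinfun"
    by (intro blinfun_eqI) simp
  have der: "(\<Psi> has_derivative blinfun_apply (\<Psi>' x)) (at x)" if "x \<in> W" for x
    by (rule has_cderiv33D(1)[OF \<Psi>'[OF that]])
  obtain U' V g g' where U': "open U'" "U' \<subseteq> W" "P \<in> U'" and V: "open V" "\<Psi> P \<in> V"
    and hom: "homeomorphism U' V \<Psi> g"
    and g': "\<And>y. y \<in> V \<Longrightarrow> (g has_derivative (g' y)) (at y)"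
      "\<And>y. y \<in> V \<Longrightarrow> g' y = inv (blinfun_apply (\<Psi>'(g y)))"
      "\<And>y. y \<in> V \<Longrightarrow> bij (blinfun_apply (\<Psi>'(g y)))"
    using inverse_function_theorem[OF W der cont P(1) id] by blast
  have gV: "g ` V = U'" and g_in: "\<And>q. q \<in> V \<Longrightarrow> g q \<in> U'" and fg: "\<And>q. q \<in> V \<Longrightarrow> \<Psi> (g q) = q"
    and gf: "\<And>p. p \<in> U' \<Longrightarrow> g (\<Psi> p) = p" and f_in: "\<And>p. p \<in> U' \<Longrightarrow> \<Psi> p \<in> V"
    using hom by (auto simp: homeomorphism_def)
  have cg: "has_cderiv33 g (g' q) q" if q: "q \<in> V" for q
    unfolding has_cderiv33_def
  proof (intro conjI allI)
    let ?L = "blinfun_apply (\<Psi>' (g q))"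
    fix c h
    have "?L (cscale3 c (inv ?L h)) = cscale3 c (?L (inv ?L h))"
      using g_in[OF q] U'(2) by (intro has_cderiv33D(2)[OF \<Psi>']) blast
    also have "\<dots> = cscale3 c h"
      using g'(3)[OF q] by (simp add: bij_is_surj surj_f_inv_f)
    finally have "inv ?L (cscale3 c h) = cscale3 c (inv ?L h)"
      using g'(3)[OF q] by (metis bij_inv_eq_iff)
    then show "g' q (cscale3 c h) = cscale3 c (g' q h)" by (simp add: g'(2)[OF q])
  qed (rule g'(1)[OF q])
  have inj: "inj_on g V" using fg by (metis inj_onI)
  have "holomorphic3_on (inv_into V g) (g ` V)"
    unfolding holomorphic3_on_iff gV
  proof (intro conjI ballI)
    fix p assume p: "p \<in> U'"
    have eq: "\<Psi> x = inv_into V g x" if "x \<in> U'" for x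
      using inv_into_f_f[OF inj f_in[OF that]] gf[OF that] by simp
    have pW: "p \<in> W" using p U'(2) by blast
    have "(inv_into V g has_derivative blinfun_apply (\<Psi>' p)) (at p)"
      by (rule has_derivative_transform_within_open[OF der[OF pW] U'(1) p eq])
    then show "\<exists>D. has_cderiv33 (inv_into V g) D p"
      using has_cderiv33D(2)[OF \<Psi>'[OF pW]] unfolding has_cderiv33_def by blast
  qed (rule U'(1))
  then have "biholomorphic3_on g V"
    unfolding biholomorphic3_on_def holomorphic3_on_iff[of g V] using inj cg V(1) by blast
  moreover have "\<exists>D'. has_cderiv33 g D' q \<and> (\<forall>h. D' (D h) = h)"
    if q: "q \<in> V" and D: "(\<Psi> has_derivative D) (at (g q))" for q D
  proof -
    have "D = blinfun_apply (\<Psi>' (g q))"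
      using has_derivative_unique[OF D der] g_in[OF q] U'(2) by blast
    then have "g' q (D h) = h" for h
      using g'(2,3)[OF q] by (simp add: bij_is_inj)
    with cg[OF q] show ?thesis by blast
  qed
  moreover have "P \<in> V" "g P = P" "\<And>q. q \<in> V \<Longrightarrow> g q \<in> W"
    using V(2) P(2) gf[OF U'(3)] g_in U'(2) by auto
  ultimately show thesis using that fg by blast
qed

subsection \<open>Conjugating the Painleve field to a linear field\<close>

lemma has_cderiv3_compose_affine:
  assumes f: "has_cderiv3 f D (g q)" and g: "(g has_derivative T) (at q)"
    and T: "\<And>c h. T (cscale3 c h) = cscale3 c (T h)"
  shows "has_cderiv3 (\<lambda>q. f (g q)) (\<lambda>h. D (T h)) q"
  using has_derivative_compose[OF g, of f D] f
  unfolding has_cderiv3_def clinear3_def by (simp only: T simp_thms)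

text \<open>Both sides of the quadratic identity for \<open>Y\<close> are differentiated and
  compared by uniqueness of the derivative. The formula is used at the origin for the tangent map
  and along the Euler field for the conjugacy.\<close>

lemma pole_functions_derivative:
  assumes pf: "\<And>p. p \<in> ball 0 \<rho> \<Longrightarrow> pole_functions s k Y P A B p" and p: "p \<in> ball 0 \<rho>"
    and Y: "has_cderiv3 Y DY p" and A: "has_cderiv3 A DA p" and B: "has_cderiv3 B DB p"
  shows "2 * (1 + Y p) * DY h = fst h + fst (snd h) + k * snd (snd h) +
    s * (snd (snd h) * (A p - B p) + snd (snd p) * (DA h - DB h))"
proof -
  let ?f = "\<lambda>q. (1 + Y q) * (1 + Y q)"
  let ?g = "\<lambda>q. 1 + fst q + fst (snd q) + k * snd (snd q) + s * (snd (snd q) * (A q - B q))"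
  note one = has_cderiv3_const[of 1 p]
  have f: "has_cderiv3 ?f (\<lambda>h. (1 + Y p) * (0 + DY h) + (0 + DY h) * (1 + Y p)) p"
    by (intro has_cderiv3_mult has_cderiv3_add one Y)
  have g: "has_cderiv3 ?g (\<lambda>h. 0 + fst h + fst (snd h) + k * snd (snd h) +
      s * (snd (snd p) * (DA h - DB h) + snd (snd h) * (A p - B p))) p"
    by (intro has_cderiv3_add one has_cderiv3_cmult has_cderiv3_mult has_cderiv3_diff has_cderiv3_coord A B)
  have "?f q = ?g q" if "q \<in> ball 0 \<rho>" for q
    using pf[OF that] by (simp add: pole_functions_def power2_eq_square mult.assoc)
  then have "(?g has_derivative (\<lambda>h. (1 + Y p) * (0 + DY h) + (0 + DY h) * (1 + Y p))) (at p)"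
    by (rule has_derivative_transform_within_open[OF f[unfolded has_cderiv3_def, THEN conjunct1] open_ball p])
  moreover have "(?g has_derivative (\<lambda>h. 0 + fst h + fst (snd h) + k * snd (snd h) +
      s * (snd (snd p) * (DA h - DB h) + snd (snd h) * (A p - B p)))) (at p)"
    using g unfolding has_cderiv3_def by blast
  ultimately have "(\<lambda>h. (1 + Y p) * (0 + DY h) + (0 + DY h) * (1 + Y p)) =
      (\<lambda>h. 0 + fst h + fst (snd h) + k * snd (snd h) +
      s * (snd (snd p) * (DA h - DB h) + snd (snd h) * (A p - B p)))"
    by (rule has_derivative_unique)
  from fun_cong[OF this, of h] show ?thesis by (simp add: algebra_simps)
qed

text \<open>The fields of the two systems in the chart, divided by \<open>y\<close>; the second one is rescaled by \<open>s\<close>, which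
  turns its eigenvalues into 4, 2, 3.\<close>

definition painleve2_field :: "complex \<Rightarrow> complex3 \<Rightarrow> complex3" where
  "painleve2_field \<alpha> q = (2 + fst (snd q) + \<alpha> * snd (snd q) - 2 * (fst q)\<^sup>2,
     snd (snd q) - 2 * fst (snd q) * fst q, - 3 * fst q * snd (snd q))"

definition linear_field :: "complex \<Rightarrow> complex \<Rightarrow> complex3 \<Rightarrow> complex3" where
  "linear_field s \<alpha> q = (4 * (fst q + s) + s * fst (snd q) + s * \<alpha> * snd (snd q),
     2 * fst (snd q) + s * snd (snd q), 3 * snd (snd q))"

text \<open>\<open>\<Psi>\<close> expresses the chart coordinates by the weighted ones, after the
  affine map \<open>g\<close> that carries the linear field to the Euler field. Differentiating
  \<open>\<Psi>\<close> along the linear field therefore needs only the Euler derivatives of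
  \<open>Y\<close> and \<open>A\<close>.\<close>

lemma painleve2_field_conjugacy:
  fixes s \<alpha> :: complex
  assumes s: "s * s = 1"
  obtains W \<Psi> where "holomorphic3_on \<Psi> W" "(-s, 0, 0) \<in> W" "\<Psi> (-s, 0, 0) = (-s, 0, 0)"
    "(\<Psi> has_derivative (\<lambda>h. h)) (at (-s, 0, 0))"
    "\<And>q. q \<in> W \<Longrightarrow> snd (snd (\<Psi> q)) = snd (snd q) \<and> fst (\<Psi> q) \<noteq> 0"
    "\<And>q. q \<in> W \<Longrightarrow> \<exists>D. (\<Psi> has_derivative D) (at q) \<and>
       cscale3 (- fst (\<Psi> q)) (D (linear_field s \<alpha> q)) = painleve2_field \<alpha> (\<Psi> q)"
proof -
  \<comment> \<open>One \<open>s\<close> belongs to the coefficient 2 \<alpha> + s in the expansion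
    of \<open>X\<^sub>2\<^sup>2\<close>, the other to the summand \<open>s e\<close> of
    \<open>z \<lambda>\<^sup>2\<close>.\<close>
  define k where "k = 2 * \<alpha> + 2 * s"
  \<comment> \<open>\<open>T\<close> diagonalises the linear part of \<open>linear_field\<close>.
    Its first row is scaled so that u + v + k e becomes -2 s times the first coordinate, which makes
    \<open>\<Psi>\<close> tangent to the identity.\<close>
  define T :: "complex3 \<Rightarrow> complex3" where
    "T h = (- 2 * s * fst h - fst (snd h) - (s + 2 * \<alpha>) * snd (snd h), fst (snd h) - s * snd (snd h), snd (snd h))" for h
  define g :: "complex3 \<Rightarrow> complex3" where "g q = T (q + (s, 0, 0))" for q
  have "norm s * norm s = 1" using s by (metis norm_mult norm_one)
  then have "norm s = 1" by (metis abs_norm_cancel abs_square_eq_1 power2_eq_square)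
  then obtain \<rho> Y P A B where \<rho>: "\<rho> > 0" and at0: "Y 0 = 0" "A 0 = 0" "B 0 = 0"
    and pf: "\<And>p. p \<in> ball 0 \<rho> \<Longrightarrow> pole_functions s k Y P A B p"
    using pole_functions_exist[of s k] by metis
  have T: "T (cscale3 c h) = cscale3 c (T h)" for c h
    by (cases h) (simp add: T_def algebra_simps)
  have g: "(g has_derivative T) (at q)" for q
    unfolding g_def T_def by (auto intro!: derivative_eq_intros)
  have g_P: "g (-s, 0, 0) = 0"
    by (simp add: g_def T_def zero_prod_def)
  define W where "W = g -` ball 0 \<rho>"
  have W: "open W"
    unfolding W_def using g by (intro open_vimage open_ball continuous_at_imp_continuous_on ballI)
      (rule has_derivative_continuous)
  have P_W: "(-s, 0, 0) \<in> W" using \<rho> g_P by (simp add: W_def)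
  define \<Psi> where "\<Psi> q = (- s * (1 + Y (g q)), fst (snd q) + (s * snd (snd q)) * A (g q), snd (snd q))" for q
  define d\<Psi> :: "complex3 \<Rightarrow> (complex3 \<Rightarrow> complex) \<Rightarrow> (complex3 \<Rightarrow> complex) \<Rightarrow> complex3 \<Rightarrow> complex3" where
    "d\<Psi> q DY DA h = (- s * (0 + DY (T h)),
       fst (snd h) + ((s * snd (snd q)) * DA (T h) + (s * snd (snd h)) * A (g q)), snd (snd h))" for q DY DA h
  have der: "has_cderiv33 \<Psi> (d\<Psi> q DY DA) q" if "has_cderiv3 Y DY (g q)" "has_cderiv3 A DA (g q)" for q DY DA
    unfolding \<Psi>_def d\<Psi>_def
    by (intro has_cderiv33_Pair has_cderiv3_cmult has_cderiv3_add has_cderiv3_mult has_cderiv3_const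
        has_cderiv3_coord has_cderiv3_compose_affine[OF _ g T] that)
  show thesis
  proof (rule that)
    show "holomorphic3_on \<Psi> W"
      unfolding holomorphic3_on_iff
    proof (intro conjI ballI W)
      fix q assume "q \<in> W"
      then have "pole_functions s k Y P A B (g q)" using pf by (simp add: W_def)
      then show "\<exists>D. has_cderiv33 \<Psi> D q" unfolding pole_functions_def using der by blast
    qed
    show "(-s, 0, 0) \<in> W" by (rule P_W)
    show "\<Psi> (-s, 0, 0) = (-s, 0, 0)" by (simp add: \<Psi>_def g_P at0)
    have "pole_functions s k Y P A B 0" using pf \<rho> by simp
    then obtain DY DA DB where D: "has_cderiv3 Y DY 0" "has_cderiv3 A DA 0" "has_cderiv3 B DB 0"
      unfolding pole_functions_def by blast
    have "DY (T h) = - s * fst h" for h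
    proof -
      have "2 * DY (T h) = fst (T h) + fst (snd (T h)) + k * snd (snd (T h))"
        using pole_functions_derivative[OF pf _ D, where h = "T h"] \<rho> by (simp add: at0)
      also have "\<dots> = 2 * (- s * fst h)"
        by (simp add: T_def k_def algebra_simps)
      finally show ?thesis by (simp only: mult_cancel_left) simp
    qed
    then have "- s * DY (T h) = fst h" for h using s by (simp flip: mult.assoc)
    then have "d\<Psi> (-s, 0, 0) DY DA h = h" for h
      by (simp add: d\<Psi>_def g_P at0)
    then have "d\<Psi> (-s, 0, 0) DY DA = (\<lambda>h. h)" by blast
    then show "(\<Psi> has_derivative (\<lambda>h. h)) (at (-s, 0, 0))"
      using has_cderiv33D(1)[OF der[of DY "(-s, 0, 0)" DA]] D g_P by simp
    fix q assume q: "q \<in> W"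
    define p where "p = g q"
    have p: "p \<in> ball 0 \<rho>" using q by (simp add: W_def p_def)
    have rel: "(1 + Y p) * (1 + P p) = 1"
      "(1 + Y p)\<^sup>2 = 1 + fst p + fst (snd p) + k * snd (snd p) + s * snd (snd p) * (A p - B p)"
      using pf[OF p] by (simp_all add: pole_functions_def)
    have "s \<noteq> 0" using s by auto
    then show "snd (snd (\<Psi> q)) = snd (snd q) \<and> fst (\<Psi> q) \<noteq> 0"
      using rel(1) by (auto simp: \<Psi>_def p_def)
    obtain DY DA DB where D: "has_cderiv3 Y DY p" "has_cderiv3 A DA p" "has_cderiv3 B DB p"
      and E: "DA (euler3 p) = P p - A p" "DB (euler3 p) = P p + B p"
      using pf[OF p] unfolding pole_functions_def by blast
    obtain a b c where abc: "q = (a, b, c)" by (cases q)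
    have ssx: "s * (s * x) = x" for x using s by (simp flip: mult.assoc)
    have T_lin: "T (linear_field s \<alpha> q) = euler3 p"
      using s by (simp add: abc linear_field_def euler3_def p_def g_def T_def algebra_simps ssx)
    have p_eq: "p = (- 2 * s * (a + s) - b - (s + 2 * \<alpha>) * c, b - s * c, c)"
      by (simp add: p_def g_def T_def abc)
    have c: "snd (snd p) = c" by (simp add: p_eq)
    have euler: "fst (euler3 p) = 4 * fst p" "fst (snd (euler3 p)) = 2 * fst (snd p)"
      "snd (snd (euler3 p)) = 3 * snd (snd p)"
      by (simp_all add: euler3_def)
    have DYe: "2 * (1 + Y p) * DY (euler3 p) =
       4 * fst p + 2 * fst (snd p) + 3 * k * c + s * c * (2 * A p - 4 * B p)"
      using pole_functions_derivative[OF pf p D, where h = "euler3 p"]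
      unfolding E euler by (simp add: c algebra_simps)
    have \<Psi>q: "\<Psi> q = (- s * (1 + Y p), b + s * c * A p, c)"
      by (simp add: \<Psi>_def abc p_def)
    have d: "d\<Psi> q DY DA (linear_field s \<alpha> q) =
       (- s * DY (euler3 p), 2 * b + s * c + (s * c * (P p - A p) + s * (3 * c) * A p), 3 * c)"
      by (simp add: d\<Psi>_def T_lin E) (simp add: abc linear_field_def p_def)
    \<comment> \<open>Only the product of \<open>1 + Y p\<close> with the derivative of
      \<open>Y\<close> is known, so the identity is proved doubled; the quadratic relation then
      eliminates the square of \<open>1 + Y p\<close>.\<close>
    have first: "s * (1 + Y p) * (- s * DY (euler3 p)) = 2 + (b + s * c * A p) + \<alpha> * c - 2 * (- s * (1 + Y p))\<^sup>2"
    proof -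
      have sq: "(- s * (1 + Y p))\<^sup>2 = (1 + Y p)\<^sup>2"
        using s by (simp add: power_mult_distrib power2_eq_square)
      have "2 * (s * (1 + Y p) * (- s * DY (euler3 p))) = - (2 * (1 + Y p) * DY (euler3 p))"
        by (simp add: algebra_simps ssx)
      also have "\<dots> = 2 * (2 + (b + s * c * A p) + \<alpha> * c - 2 * (- s * (1 + Y p))\<^sup>2)"
        unfolding DYe sq rel(2) by (simp add: p_eq k_def algebra_simps ssx)
      finally show ?thesis by (simp only: mult_cancel_left) simp
    qed
    \<comment> \<open>The terms in \<open>P\<close> combine to (1 + Y) (1 + P) = 1, which leaves a
      polynomial field.\<close>
    have second: "s * (1 + Y p) * (2 * b + s * c + (s * c * (P p - A p) + s * (3 * c) * A p))
      = c - 2 * (b + s * c * A p) * (- s * (1 + Y p))"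
    proof -
      have "s * (1 + Y p) * (2 * b + s * c + (s * c * (P p - A p) + s * (3 * c) * A p))
         = s * s * c * ((1 + Y p) * (1 + P p)) - 2 * (b + s * c * A p) * (- s * (1 + Y p))"
        by (simp add: algebra_simps)
      then show ?thesis using s rel(1) by simp
    qed
    have "cscale3 (- fst (\<Psi> q)) (d\<Psi> q DY DA (linear_field s \<alpha> q)) = painleve2_field \<alpha> (\<Psi> q)"
      using first second unfolding d \<Psi>q painleve2_field_def by simp
    moreover have "(\<Psi> has_derivative d\<Psi> q DY DA) (at q)"
      using has_cderiv33D(1)[OF der[of DY q DA]] D unfolding p_def by blast
    ultimately show "\<exists>D. (\<Psi> has_derivative D) (at q) \<and>
       cscale3 (- fst (\<Psi> q)) (D (linear_field s \<alpha> q)) = painleve2_field \<alpha> (\<Psi> q)"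
      by blast
  qed
qed

section \<open>From conjugate vector fields to transformed solutions\<close>

text \<open>Near \<open>z0\<close> the function \<open>w\<close> has a holomorphic inverse because
  \<open>w'\<close> does not vanish; composing with it cancels the factor \<open>w'\<close> by the
  chain rule.\<close>

lemma solves_on_reparametrised:
  assumes S: "open S" "z0 \<in> S"
    and w: "\<And>z. z \<in> S \<Longrightarrow> (w has_field_derivative w' z) (at z)" "\<And>z. z \<in> S \<Longrightarrow> w' z \<noteq> 0"
    and a: "\<And>z. z \<in> S \<Longrightarrow> (a has_field_derivative w' z * fst (G (a z) (b z) (w z))) (at z)"
    and b: "\<And>z. z \<in> S \<Longrightarrow> (b has_field_derivative w' z * snd (G (a z) (b z) (w z))) (at z)"
  shows "\<exists>T xt yt. open T \<and> z0 \<in> T \<and> T \<subseteq> S \<and> inj_on w T \<and> solves_on G (w ` T) xt yt \<and>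
    (\<forall>z\<in>T. xt (w z) = a z \<and> yt (w z) = b z)"
proof -
  have "w holomorphic_on S"
    using w(1) S(1) by (auto simp: holomorphic_on_open)
  moreover have "deriv w z0 \<noteq> 0" using DERIV_imp_deriv w S(2) by metis
  ultimately obtain r where r: "r > 0" "ball z0 r \<subseteq> S" "inj_on w (ball z0 r)"
    using has_complex_derivative_locally_injective S by blast
  define T where "T = ball z0 r"
  have T: "open T" "T \<subseteq> S" "inj_on w T" using r by (auto simp: T_def)
  have hol: "w holomorphic_on T"
    using w(1) T by (auto simp: holomorphic_on_open)
  obtain g where g: "g holomorphic_on (w ` T)" "\<And>z. z \<in> T \<Longrightarrow> deriv w z * deriv g (w z) = 1"
      "\<And>z. z \<in> T \<Longrightarrow> g (w z) = z"
    using holomorphic_has_inverse[OF hol T(1) T(3)] by metis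
  have openw: "open (w ` T)" using open_mapping_thm3[OF hol T(1) T(3)] .
  have chain: "((\<lambda>\<zeta>. f (g \<zeta>)) has_field_derivative d) (at (w z))"
    if z: "z \<in> T" and f: "(f has_field_derivative w' z * d) (at z)" for f z d
  proof -
    have zS: "z \<in> S" using z T by blast
    have "(g has_field_derivative deriv g (w z)) (at (w z))"
      using g(1) openw z holomorphic_derivI by blast
    moreover have "w' z * deriv g (w z) = 1"
      using g(2)[OF z] DERIV_imp_deriv[OF w(1)[OF zS]] by simp
    ultimately have "((\<lambda>\<zeta>. f (g \<zeta>)) has_field_derivative (w' z * d) * deriv g (w z)) (at (w z))"
      using f by (intro DERIV_chain2[of f "w' z * d" g "w z" "deriv g (w z)"]) (simp_all add: g(3)[OF z])
    moreover have "(w' z * d) * deriv g (w z) = (w' z * deriv g (w z)) * d"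
      by simp
    ultimately show ?thesis
      using \<open>w' z * deriv g (w z) = 1\<close> by simp
  qed
  have "solves_on G (w ` T) (\<lambda>\<zeta>. a (g \<zeta>)) (\<lambda>\<zeta>. b (g \<zeta>))"
    unfolding solves_on_def
    using openw T(2) a b g(3) by (auto intro!: chain)
  then show ?thesis
    using T r(1) g(3) by (intro exI[of _ T] exI[of _ "\<lambda>\<zeta>. a (g \<zeta>)"] exI[of _ "\<lambda>\<zeta>. b (g \<zeta>)"])
      (simp add: T_def)
qed

lemma chart2_derivative:
  assumes x: "(x has_field_derivative 2 * y z ^ 3 + y z * z + \<alpha>) (at z)"
    and y: "(y has_field_derivative x z) (at z)" and nz: "y z \<noteq> 0"
  shows "((\<lambda>z. chart2 (x z) (y z) z) has_derivative
    (\<lambda>h. cscale3 (h * y z) (painleve2_field \<alpha> (chart2 (x z) (y z) z)))) (at z)"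
proof -
  let ?V = "painleve2_field \<alpha> (chart2 (x z) (y z) z)"
  have "((\<lambda>z. x z / y z ^ 2) has_field_derivative y z * fst ?V) (at z)"
    by (rule derivative_eq_intros x y refl | simp add: nz)+
      (simp add: nz painleve2_field_def chart2_def field_simps eval_nat_numeral)
  moreover have "((\<lambda>z. z / y z ^ 2) has_field_derivative y z * fst (snd ?V)) (at z)"
    by (rule derivative_eq_intros x y refl | simp add: nz)+
      (simp add: nz painleve2_field_def chart2_def field_simps eval_nat_numeral)
  moreover have "((\<lambda>z. 1 / y z ^ 3) has_field_derivative y z * snd (snd ?V)) (at z)"
    by (rule derivative_eq_intros x y refl | simp add: nz)+
      (simp add: nz painleve2_field_def chart2_def field_simps eval_nat_numeral)
  ultimately have "((\<lambda>z. (x z / y z ^ 2, z / y z ^ 2, 1 / y z ^ 3)) has_derivative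
     (\<lambda>h. (y z * fst ?V * h, y z * fst (snd ?V) * h, y z * snd (snd ?V) * h))) (at z)"
    unfolding has_field_derivative_def by (intro has_derivative_Pair)
  moreover have "(y z * fst ?V * h, y z * fst (snd ?V) * h, y z * snd (snd ?V) * h) = cscale3 (h * y z) ?V" for h
    by (cases ?V) (simp add: mult_ac)
  ultimately show ?thesis by (simp add: chart2_def[abs_def])
qed

text \<open>Along a solution, \<open>\<Phi>\<close> turns the Painleve field into
  \<open>linear_field\<close> times \<open>- y X\<^sub>2\<close>. Multiplication by
  \<open>y\<^sup>2\<close> then yields the solvable system with the common rate
  \<open>- s X\<^sub>2\<close> in front.\<close>

lemma transforms_into_solvable_system:
  assumes s: "s * s = 1"
    and inverse: "\<And>q. q \<in> U \<Longrightarrow> \<Phi> q \<in> W" "\<And>q. q \<in> U \<Longrightarrow> \<Psi> (\<Phi> q) = q"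
    and eps: "\<And>q. q \<in> U \<Longrightarrow> snd (snd (\<Phi> q)) = snd (snd q)"
    and nz: "\<And>p. p \<in> W \<Longrightarrow> fst (\<Psi> p) \<noteq> 0"
    and conj: "\<And>p. p \<in> W \<Longrightarrow> \<exists>D. (\<Psi> has_derivative D) (at p) \<and>
       cscale3 (- fst (\<Psi> p)) (D (linear_field s \<alpha> p)) = painleve2_field \<alpha> (\<Psi> p)"
    and der: "\<And>q D. q \<in> U \<Longrightarrow> (\<Psi> has_derivative D) (at (\<Phi> q)) \<Longrightarrow>
       \<exists>D'. has_cderiv33 \<Phi> D' q \<and> (\<forall>h. D' (D h) = h)"
  shows "transforms_into \<Phi> U (painleve2 \<alpha>) (solvable_system s \<alpha>)"
  unfolding transforms_into_def
proof (intro allI impI ballI)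
  fix S x y z0
  assume asm: "solves_on (painleve2 \<alpha>) S x y \<and> (\<forall>z\<in>S. y z \<noteq> 0 \<and> chart2 (x z) (y z) z \<in> U)"
    and z0: "z0 \<in> S"
  have S: "open S" and x: "\<And>z. z \<in> S \<Longrightarrow> (x has_field_derivative 2 * y z ^ 3 + y z * z + \<alpha>) (at z)"
    and y: "\<And>z. z \<in> S \<Longrightarrow> (y has_field_derivative x z) (at z)"
    and y0: "\<And>z. z \<in> S \<Longrightarrow> y z \<noteq> 0" and U: "\<And>z. z \<in> S \<Longrightarrow> chart2 (x z) (y z) z \<in> U"
    using asm by (auto simp: solves_on_def painleve2_def)
  let ?X = "\<lambda>z. x z / y z ^ 2" and ?p = "\<lambda>z. \<Phi> (chart2 (x z) (y z) z)"
  have s0: "s \<noteq> 0" using s by auto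
  have X0: "?X z \<noteq> 0" if "z \<in> S" for z
  proof -
    have "?X z = fst (\<Psi> (?p z))" using inverse(2)[OF U[OF that]] by (simp add: chart2_def)
    then show ?thesis using nz[OF inverse(1)[OF U[OF that]]] by simp
  qed
  have p_deriv: "(?p has_derivative (\<lambda>h. cscale3 (h * (- (y z * ?X z))) (linear_field s \<alpha> (?p z)))) (at z)"
    if z: "z \<in> S" for z
  proof -
    let ?q = "chart2 (x z) (y z) z"
    obtain D where D: "(\<Psi> has_derivative D) (at (?p z))"
      "cscale3 (- fst (\<Psi> (?p z))) (D (linear_field s \<alpha> (?p z))) = painleve2_field \<alpha> (\<Psi> (?p z))"
      using conj[OF inverse(1)[OF U[OF z]]] by blast
    obtain D' where D': "has_cderiv33 \<Phi> D' ?q" "\<And>h. D' (D h) = h"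
      using der[OF U[OF z] D(1)] by blast
    have "fst ?q = ?X z" by (simp add: chart2_def)
    then have V: "painleve2_field \<alpha> ?q = cscale3 (- ?X z) (D (linear_field s \<alpha> (?p z)))"
      using D(2) inverse(2)[OF U[OF z]] by simp
    have "D' (cscale3 (h * y z) (painleve2_field \<alpha> ?q)) =
        cscale3 (h * (- (y z * ?X z))) (linear_field s \<alpha> (?p z))" for h
      unfolding V by (simp add: has_cderiv33D(2)[OF D'(1)] D'(2) cscale3_cscale3 mult.assoc)
    then show ?thesis
      using has_derivative_compose[OF chart2_derivative[OF x[OF z] y[OF z] y0[OF z]] has_cderiv33D(1)[OF D'(1)]]
      by simp
  qed
  have e: "snd (snd (?p z)) = 1 / y z ^ 3" if "z \<in> S" for z
    using eps[OF U[OF that]] by (simp add: chart2_def)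
  have u_deriv: "((\<lambda>z. fst (?p z)) has_field_derivative
      - (y z * ?X z) * (4 * (fst (?p z) + s) + s * fst (snd (?p z)) + s * \<alpha> * (1 / y z ^ 3))) (at z)"
    and v_deriv: "((\<lambda>z. fst (snd (?p z))) has_field_derivative
      - (y z * ?X z) * (2 * fst (snd (?p z)) + s * (1 / y z ^ 3))) (at z)" if z: "z \<in> S" for z
  proof -
    note fst_der = has_derivative_fst[OF p_deriv[OF z]]
    have *: "(\<lambda>h. h * c * d) = (*) (c * d)" for c d :: complex
      by (auto simp: mult_ac)
    from fst_der show "((\<lambda>z. fst (?p z)) has_field_derivative
      - (y z * ?X z) * (4 * (fst (?p z) + s) + s * fst (snd (?p z)) + s * \<alpha> * (1 / y z ^ 3))) (at z)"
      unfolding has_field_derivative_def cscale3_coord * by (simp only: linear_field_def fst_conv e[OF z])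
    from has_derivative_fst[OF has_derivative_snd[OF p_deriv[OF z]]]
    show "((\<lambda>z. fst (snd (?p z))) has_field_derivative
      - (y z * ?X z) * (2 * fst (snd (?p z)) + s * (1 / y z ^ 3))) (at z)"
      unfolding has_field_derivative_def cscale3_coord * by (simp only: linear_field_def fst_conv snd_conv e[OF z])
  qed
  show "\<exists>T xt yt. open T \<and> z0 \<in> T \<and> T \<subseteq> S \<and> inj_on (\<lambda>z. new_z \<Phi> (x z) (y z) z) T \<and>
      solves_on (solvable_system s \<alpha>) ((\<lambda>z. new_z \<Phi> (x z) (y z) z) ` T) xt yt \<and>
      (\<forall>z\<in>T. xt (new_z \<Phi> (x z) (y z) z) = new_x \<Phi> (x z) (y z) z \<and> yt (new_z \<Phi> (x z) (y z) z) = y z)"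
  proof (rule solves_on_reparametrised[where w' = "\<lambda>z. - s * ?X z", OF S z0])
    fix z assume z: "z \<in> S"
    have y2: "((\<lambda>z. y z ^ 2) has_field_derivative 2 * y z * x z) (at z)"
      by (rule derivative_eq_intros y[OF z] refl)+ simp
    have ssx: "s * (s * c) = c" for c using s by (simp flip: mult.assoc)
    show "- s * ?X z \<noteq> 0" using s0 X0[OF z] by simp
    \<comment> \<open>By \<open>x = X\<^sub>2 y\<^sup>2\<close> the terms with the second coordinate
      cancel, so the new independent variable has the nonvanishing derivative
      \<open>- s X\<^sub>2\<close>.\<close>
    have "- (y z * ?X z) * (2 * fst (snd (?p z)) + s * (1 / y z ^ 3)) * (y z)\<^sup>2
        + 2 * y z * x z * fst (snd (?p z)) = - s * ?X z"
      using y0[OF z] by (simp add: field_simps eval_nat_numeral)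
    then show "((\<lambda>z. new_z \<Phi> (x z) (y z) z) has_field_derivative - s * ?X z) (at z)"
      using DERIV_mult[OF v_deriv[OF z] y2] unfolding new_z_def by simp
    have "- (y z * ?X z) * (4 * (fst (?p z) + s) + s * fst (snd (?p z)) + s * \<alpha> * (1 / y z ^ 3)) * (y z)\<^sup>2
        + 2 * y z * x z * fst (?p z) =
        - s * ?X z * (s * (2 * (fst (?p z) * (y z)\<^sup>2) * y z) + 4 * y z ^ 3
          + fst (snd (?p z)) * (y z)\<^sup>2 * y z + \<alpha>)"
      using y0[OF z] by (simp add: field_simps eval_nat_numeral ssx)
    then show "((\<lambda>z. new_x \<Phi> (x z) (y z) z) has_field_derivative - s * ?X z *
        fst (solvable_system s \<alpha> (new_x \<Phi> (x z) (y z) z) (y z) (new_z \<Phi> (x z) (y z) z))) (at z)"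
      using DERIV_mult[OF u_deriv[OF z] y2]
      unfolding new_x_def new_z_def solvable_system_def fst_conv by simp
    have "- s * ?X z * (- s * (y z)\<^sup>2) = x z"
      using y0[OF z] s by (simp add: field_simps)
    then show "(y has_field_derivative - s * ?X z *
        snd (solvable_system s \<alpha> (new_x \<Phi> (x z) (y z) z) (y z) (new_z \<Phi> (x z) (y z) z))) (at z)"
      using y[OF z] unfolding solvable_system_def snd_conv by simp
  qed
qed

theorem proposition3p4:
  fixes \<alpha> s :: complex
  assumes "s = 1 \<or> s = -1"
  shows "\<exists>U \<Phi>. local_transformation_near (- s, 0, 0) U \<Phi> \<and>
           transforms_into \<Phi> U (painleve2 \<alpha>) (solvable_system s \<alpha>)"
proof -
  have s: "s * s = 1" using assms by auto
  obtain W \<Psi> where \<Psi>: "holomorphic3_on \<Psi> W" "(-s, 0, 0) \<in> W" "\<Psi> (-s, 0, 0) = (-s, 0, 0)"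
    "(\<Psi> has_derivative (\<lambda>h. h)) (at (-s, 0, 0))"
    and coord: "\<And>q. q \<in> W \<Longrightarrow> snd (snd (\<Psi> q)) = snd (snd q) \<and> fst (\<Psi> q) \<noteq> 0"
    and conj: "\<And>q. q \<in> W \<Longrightarrow> \<exists>D. (\<Psi> has_derivative D) (at q) \<and>
       cscale3 (- fst (\<Psi> q)) (D (linear_field s \<alpha> q)) = painleve2_field \<alpha> (\<Psi> q)"
    by (rule painleve2_field_conjugacy[OF s, of \<alpha>]) blast
  obtain U \<Phi> where U: "(-s, 0, 0) \<in> U" "biholomorphic3_on \<Phi> U" "\<Phi> (-s, 0, 0) = (-s, 0, 0)"
    and inverse: "\<And>q. q \<in> U \<Longrightarrow> \<Phi> q \<in> W" "\<And>q. q \<in> U \<Longrightarrow> \<Psi> (\<Phi> q) = q"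
    and der: "\<And>q D. q \<in> U \<Longrightarrow> (\<Psi> has_derivative D) (at (\<Phi> q)) \<Longrightarrow>
       \<exists>D'. has_cderiv33 \<Phi> D' q \<and> (\<forall>h. D' (D h) = h)"
    by (rule holomorphic3_local_inverse[OF \<Psi>]) blast
  have eps: "snd (snd (\<Phi> q)) = snd (snd q)" if "q \<in> U" for q
    using coord[OF inverse(1)[OF that]] inverse(2)[OF that] by simp
  have "local_transformation_near (-s, 0, 0) U \<Phi>"
    unfolding local_transformation_near_def using U eps by blast
  moreover have "transforms_into \<Phi> U (painleve2 \<alpha>) (solvable_system s \<alpha>)"
    by (rule transforms_into_solvable_system[OF s inverse eps _ conj der]) (use coord in blast)+
  ultimately show ?thesis by blast
qed

end
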